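(* Let $X$, $Y$ be Banach spaces with $Y$ continuously embedded in $X$, let $T\in(0,\infty]$, and assume: (a) $G$ generates a $C_0$-semigroup $(S(t))_{t\ge0}$ on $X$ such that $S(t)Y\subseteq Y$ for every $t\ge0$ and $t\mapsto S(t)y$ is continuous from $[0,\infty)$ to $Y$ for every $y\in Y$; (b) there is $\eta:(0,\infty)\to(0,\infty)$ with $\eta(\delta)\to0$ as $\delta\to0^+$ such that for all $0\le s_0<s_1$ and all $\varphi\in C([s_0,s_1],X)$, $\int_{s_0}^{s_1}S(s_1-s)\varphi(s)\,ds\in Y$ and $\bigl\|\int_{s_0}^{s_1}S(s_1-s)\varphi(s)\,ds\bigr\|_Y\le\eta(s_1-s_0)\|\varphi\|_{C([s_0,s_1],X)}$; (c) $F:[0,T)\times Y\to X$ is continuous and satisfies a Lipschitz condition in the second argument on bounded sets, uniformly in the first argument on compact intervals; (d) $X$ and $Y$ are Banach lattices, $Y$ is a sublattice of $X$, and $\mathcal D(G)$ is a dense subspace of $Y$; (e) there exists a positive linear operator $H:Y\to X$ such that for every $\gamma\ge0$ the operator $G-\gamma H$ generates a positive semigroup $(S_\gamma(t))_{t\ge0}$ on $X$ and $S_\gamma(t)Y\subseteq Y$ for all $t\ge0$; (f) for every $\tau\in[0,T)$ and every $r>0$ there exists $\gamma\ge0$ such that $F(t,v)+\gamma Hv\ge0$ for all $v\in Y_+$ with $\|v\|_Y\le r$ and all $t\in[0,\tau]$. Let $\mathring u\in Y_+$ and let $u$ be the unique maximal mild solution on $[0,t_{\max})$, $t_{\max}\in(0,T]$,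 of $u'=Gu+F(t,u)$, $u(0)=\mathring u$. Then $u(t)\ge0$ for all $t\in[0,t_{\max})$.
   Context: $F$ satisfies a Lipschitz condition in the second argument on bounded sets, uniformly in the first argument on compact intervals, if for every $t'\in[0,T)$ and $r>0$ there is $L$ with $\|F(t,f)-F(t,g)\|_X\le L\|f-g\|_Y$ for all $\|f\|_Y,\|g\|_Y\le r$, $t\in[0,t']$. A mild solution on $[0,t_1)$ is $u\in C([0,t_1),Y)$ with $u(t)=S(t)\mathring u+\int_0^tS(t-s)F(s,u(s))\,ds$ for $t\in[0,t_1)$; it is maximal if it cannot be extended to a mild solution on $[0,\tilde t_1)$ with $t_1<\tilde t_1\le T$. (Under (a)–(c) such a unique maximal mild solution exists.) A semigroup is positive if each $S(t)$ maps $X_+$ into $X_+$; an operator is positive if it maps non-negative elements to non-negative elements; $Y_+$ denotes the non-negative elements of $Y$. *)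

theory Defs
  imports "HOL-Analysis.Analysis" "HOL-Library.Extended_Real"
begin

text \<open>Throughout, the Banach space X is the ambient type 'x, carrying the type-class
  order (a vector lattice: ordered real vector space that is a lattice).
  Y is a subset of X with its own norm nY.\<close>

type_synonym 'x op = "'x \<Rightarrow> 'x"

definition lmod :: "'x::{ordered_real_vector,lattice} \<Rightarrow> 'x" where
  "lmod x = sup x (- x)"

definition banach_lattice_X :: "'x::{banach,ordered_real_vector,lattice} itself \<Rightarrow> bool" where
  "banach_lattice_X _ \<longleftrightarrow> (\<forall>x y::'x. lmod x \<le> lmod y \<longrightarrow> norm x \<le> norm y)"

definition normed_subspace :: "'x::real_vector set \<Rightarrow> ('x \<Rightarrow> real) \<Rightarrow> bool" where
  "normed_subspace Y nY \<longleftrightarrow> subspace Y \<and>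
     (\<forall>y\<in>Y. 0 \<le> nY y) \<and> (\<forall>y\<in>Y. nY y = 0 \<longleftrightarrow> y = 0) \<and>
     (\<forall>a. \<forall>y\<in>Y. nY (a *\<^sub>R y) = \<bar>a\<bar> * nY y) \<and>
     (\<forall>y\<in>Y. \<forall>z\<in>Y. nY (y + z) \<le> nY y + nY z)"

definition complete_wrt :: "'x::real_vector set \<Rightarrow> ('x \<Rightarrow> real) \<Rightarrow> bool" where
  "complete_wrt Y nY \<longleftrightarrow> (\<forall>f::nat \<Rightarrow> 'x. (\<forall>n. f n \<in> Y) \<longrightarrow>
     (\<forall>e>0. \<exists>N. \<forall>m\<ge>N. \<forall>n\<ge>N. nY (f m - f n) < e) \<longrightarrow>
     (\<exists>l\<in>Y. (\<lambda>n. nY (f n - l)) \<longlonglongrightarrow> 0))"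

definition banach_embedded :: "'x::real_normed_vector set \<Rightarrow> ('x \<Rightarrow> real) \<Rightarrow> bool" where
  "banach_embedded Y nY \<longleftrightarrow> normed_subspace Y nY \<and> complete_wrt Y nY \<and>
     (\<exists>C. \<forall>y\<in>Y. norm y \<le> C * nY y)"

definition banach_sublattice :: "'x::{banach,ordered_real_vector,lattice} set \<Rightarrow> ('x \<Rightarrow> real) \<Rightarrow> bool" where
  "banach_sublattice Y nY \<longleftrightarrow> (\<forall>y\<in>Y. \<forall>z\<in>Y. sup y z \<in> Y \<and> inf y z \<in> Y) \<and>
     (\<forall>y\<in>Y. \<forall>z\<in>Y. lmod y \<le> lmod z \<longrightarrow> nY y \<le> nY z)"

definition C0_semigroup :: "(real \<Rightarrow> 'x::banach op) \<Rightarrow> bool" where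
  "C0_semigroup S \<longleftrightarrow> (\<forall>t\<ge>0. bounded_linear (S t)) \<and> S 0 = id \<and>
     (\<forall>t\<ge>0. \<forall>s\<ge>0. S (t + s) = S t \<circ> S s) \<and>
     (\<forall>x. continuous_on {0..} (\<lambda>t. S t x))"

definition generates :: "'x set \<Rightarrow> 'x op \<Rightarrow> (real \<Rightarrow> 'x::banach op) \<Rightarrow> bool" where
  "generates D A S \<longleftrightarrow> C0_semigroup S \<and>
     (\<forall>x. x \<in> D \<longleftrightarrow> (\<exists>v. ((\<lambda>h. (1 / h) *\<^sub>R (S h x - x)) \<longlongrightarrow> v) (at_right 0))) \<and>
     (\<forall>x\<in>D. ((\<lambda>h. (1 / h) *\<^sub>R (S h x - x)) \<longlongrightarrow> A x) (at_right 0))"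

definition positive_semigroup :: "(real \<Rightarrow> 'x::{banach,ordered_real_vector,lattice} op) \<Rightarrow> bool" where
  "positive_semigroup S \<longleftrightarrow> (\<forall>t\<ge>0. \<forall>x. 0 \<le> x \<longrightarrow> 0 \<le> S t x)"

definition Ycontinuous_on :: "('x \<Rightarrow> real) \<Rightarrow> real set \<Rightarrow> (real \<Rightarrow> 'x::real_vector) \<Rightarrow> bool" where
  "Ycontinuous_on nY A u \<longleftrightarrow> (\<forall>t\<in>A. \<forall>e>0. \<exists>d>0. \<forall>s\<in>A. \<bar>s - t\<bar> < d \<longrightarrow> nY (u s - u t) < e)"

definition Ico0 :: "ereal \<Rightarrow> real set" where
  "Ico0 T = {t. 0 \<le> t \<and> ereal t < T}"

definition F_continuous :: "ereal \<Rightarrow> 'x set \<Rightarrow> ('x \<Rightarrow> real) \<Rightarrow> (real \<Rightarrow> 'x \<Rightarrow> 'x::real_normed_vector) \<Rightarrow> bool" where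
  "F_continuous T Y nY F \<longleftrightarrow> (\<forall>t\<in>Ico0 T. \<forall>y\<in>Y. \<forall>e>0. \<exists>d>0. \<forall>t'\<in>Ico0 T. \<forall>y'\<in>Y.
      \<bar>t' - t\<bar> < d \<longrightarrow> nY (y' - y) < d \<longrightarrow> norm (F t' y' - F t y) < e)"

definition F_loc_Lipschitz :: "ereal \<Rightarrow> 'x set \<Rightarrow> ('x \<Rightarrow> real) \<Rightarrow> (real \<Rightarrow> 'x \<Rightarrow> 'x::real_normed_vector) \<Rightarrow> bool" where
  "F_loc_Lipschitz T Y nY F \<longleftrightarrow> (\<forall>t'\<in>Ico0 T. \<forall>r>0. \<exists>L. \<forall>t\<in>{0..t'}. \<forall>f\<in>Y. \<forall>g\<in>Y.
      nY f \<le> r \<longrightarrow> nY g \<le> r \<longrightarrow> norm (F t f - F t g) \<le> L * nY (f - g))"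

definition mild_solution :: "'x set \<Rightarrow> ('x \<Rightarrow> real) \<Rightarrow> (real \<Rightarrow> 'x::banach op) \<Rightarrow>
    (real \<Rightarrow> 'x \<Rightarrow> 'x) \<Rightarrow> 'x \<Rightarrow> ereal \<Rightarrow> (real \<Rightarrow> 'x) \<Rightarrow> bool" where
  "mild_solution Y nY S F u0 t1 u \<longleftrightarrow>
     (\<forall>t\<in>Ico0 t1. u t \<in> Y) \<and> Ycontinuous_on nY (Ico0 t1) u \<and>
     (\<forall>t\<in>Ico0 t1. u t = S t u0 + integral {0..t} (\<lambda>s. S (t - s) (F s (u s))))"

definition maximal_mild_solution :: "ereal \<Rightarrow> 'x set \<Rightarrow> ('x \<Rightarrow> real) \<Rightarrow> (real \<Rightarrow> 'x::banach op) \<Rightarrow>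
    (real \<Rightarrow> 'x \<Rightarrow> 'x) \<Rightarrow> 'x \<Rightarrow> ereal \<Rightarrow> (real \<Rightarrow> 'x) \<Rightarrow> bool" where
  "maximal_mild_solution T Y nY S F u0 t1 u \<longleftrightarrow> mild_solution Y nY S F u0 t1 u \<and>
     \<not> (\<exists>t2 v. t1 < t2 \<and> t2 \<le> T \<and> mild_solution Y nY S F u0 t2 v \<and> (\<forall>t\<in>Ico0 t1. v t = u t))"

end

theory Submission
  imports Defs
begin

text \<open>
  Since \<open>t S(t) x = \<integral>\<^sub>0\<^sup>t S(t - s) S(s) x ds\<close>, hypothesis (b) makes \<open>S(t)\<close> map \<open>X\<close> boundedly into \<open>Y\<close>
  for \<open>t > 0\<close>, and \<open>H\<close> is bounded from \<open>Y\<close> to \<open>X\<close>, being positive. Differentiating \<open>s \<mapsto> S\<^sub>\<gamma>(t - s) u(s)\<close> from the right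
  shows that a mild solution satisfies
  \<open>u(t) = S\<^sub>\<gamma>(t) u(0) + \<integral>\<^sub>0\<^sup>t S\<^sub>\<gamma>(t - s) (F(s, u(s)) + \<gamma> H u(s)) ds\<close>.
  The case \<open>\<gamma> = 0\<close> gives positivity of \<open>S\<close>, and the orbits of \<open>S\<close> give \<open>0 \<le> S\<^sub>\<gamma>(t) \<le> S(t)\<close>.
  Replacing \<open>u\<close> by \<open>u\<^sup>+\<close> in the integrand costs a term \<open>g\<close> with \<open>\<parallel>g\<parallel>\<^sub>X \<le> C \<parallel>u\<^sup>-\<parallel>\<^sub>Y\<close>, so (f) yields
  \<open>u\<^sup>-(t) \<le> \<integral>\<^sub>0\<^sup>t S(t - s) |g(s)| ds\<close>; by (b) the \<open>Y\<close>-norm of \<open>u\<^sup>-\<close> is at most half its own supremum on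
  short intervals, and \<open>u\<^sup>-\<close> vanishes step by step.
\<close>

section \<open>Banach lattices\<close>

text \<open>Translation by \<open>a\<close> is an order automorphism, so it preserves suprema; the
  nontrivial inequality is checked after translating back by \<open>- a\<close>.\<close>

lemma add_sup_distrib:
  fixes a b c :: "'x::{ordered_real_vector,lattice}"
  shows "a + sup b c = sup (a + b) (a + c)"
proof (rule antisym)
  have "b \<le> sup (a + b) (a + c) - a" "c \<le> sup (a + b) (a + c) - a"
    by (simp_all add: le_diff_eq add.commute)
  then have "sup b c \<le> sup (a + b) (a + c) - a"
    by (rule le_supI)
  then show "a + sup b c \<le> sup (a + b) (a + c)"
    by (simp add: le_diff_eq add.commute)
qed simp

text \<open>Riesz decomposition into positive and negative part: translating
  \<open>sup (- x) 0\<close> by \<open>x\<close> yields \<open>sup 0 x\<close>.\<close>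

lemma sup_zero_minus:
  fixes x :: "'x::{ordered_real_vector,lattice}"
  shows "sup x 0 - sup (- x) 0 = x"
  using add_sup_distrib[of x "- x" 0] by (simp add: algebra_simps sup_commute)

lemma lmod_ge:
  fixes x :: "'x::{ordered_real_vector,lattice}"
  shows "x \<le> lmod x" "- x \<le> lmod x"
  by (simp_all add: lmod_def)

lemma lmod_least:
  fixes x :: "'x::{ordered_real_vector,lattice}"
  shows "x \<le> a \<Longrightarrow> - x \<le> a \<Longrightarrow> lmod x \<le> a"
  by (simp add: lmod_def)

lemma lmod_nonneg:
  fixes x :: "'x::{ordered_real_vector,lattice}"
  shows "0 \<le> lmod x"
proof -
  have "0 \<le> lmod x + lmod x"
    using add_mono[OF lmod_ge(1)[of x] lmod_ge(2)[of x]] by simp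
  then have "0 \<le> (1/2) *\<^sub>R (lmod x + lmod x)"
    by (intro scaleR_nonneg_nonneg) auto
  then show ?thesis
    by (metis scaleR_half_double)
qed

lemma lmod_of_nonneg:
  fixes x :: "'x::{ordered_real_vector,lattice}"
  assumes "0 \<le> x"
  shows "lmod x = x"
proof -
  have "- x \<le> x"
    using assms by (meson neg_le_0_iff_le order_trans)
  then show ?thesis
    by (simp add: lmod_def sup_absorb1)
qed

lemma lmod_minus [simp]: "lmod (- x) = lmod x"
  for x :: "'x::{ordered_real_vector,lattice}"
  by (simp add: lmod_def sup_commute)

lemma lmod_lmod_diff:
  fixes x y :: "'x::{ordered_real_vector,lattice}"
  shows "lmod (lmod x - lmod y) \<le> lmod (x - y)"
proof -
  have *: "lmod x \<le> lmod y + lmod (x - y)" for x y :: 'x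
    using add_mono[OF lmod_ge(1)[of y] lmod_ge(1)[of "x - y"]]
      add_mono[OF lmod_ge(2)[of y] lmod_ge(2)[of "x - y"]]
    by (intro lmod_least) simp_all
  show ?thesis
    using *[of x y] *[of y x] lmod_minus[of "x - y"]
    by (intro lmod_least) (simp_all add: diff_le_eq add.commute)
qed

text \<open>Taking positive parts is a contraction in the lattice sense. For a lattice norm this
  becomes Lipschitz constant 1, which later carries \<open>Y\<close>-continuity from
  \<open>u\<close> to its positive and negative parts.\<close>

lemma lmod_sup_zero_diff:
  fixes x y :: "'x::{ordered_real_vector,lattice}"
  shows "lmod (sup x 0 - sup y 0) \<le> lmod (x - y)"
proof -
  have *: "sup x 0 \<le> sup y 0 + lmod (x - y)" for x y :: 'x
    using add_mono[OF sup_ge1[of y 0] lmod_ge(1)[of "x - y"]]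
      add_mono[OF sup_ge2[of 0 y] lmod_nonneg[of "x - y"]]
    by (intro le_supI) simp_all
  show ?thesis
    using *[of x y] *[of y x] lmod_minus[of "x - y"]
    by (intro lmod_least) (simp_all add: diff_le_eq add.commute)
qed

lemma banach_lattice_normD:
  assumes "banach_lattice_X TYPE('x::{banach,ordered_real_vector,lattice})"
    and "lmod (x :: 'x) \<le> lmod y"
  shows "norm x \<le> norm y"
  using assms by (simp add: banach_lattice_X_def)

lemma norm_mono_nonneg:
  assumes "banach_lattice_X TYPE('x::{banach,ordered_real_vector,lattice})"
    and "0 \<le> (x :: 'x)" "x \<le> y"
  shows "norm x \<le> norm y"
  using assms lmod_of_nonneg[of x] lmod_of_nonneg[of y]
  by (intro banach_lattice_normD) auto

lemma norm_lmod:
  assumes "banach_lattice_X TYPE('x::{banach,ordered_real_vector,lattice})"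
  shows "norm (lmod (x :: 'x)) = norm x"
  using assms lmod_of_nonneg[OF lmod_nonneg[of x]]
  by (intro antisym banach_lattice_normD) auto

lemma continuous_on_lmod:
  assumes "banach_lattice_X TYPE('x::{banach,ordered_real_vector,lattice})"
    and "continuous_on A (f :: real \<Rightarrow> 'x)"
  shows "continuous_on A (\<lambda>t. lmod (f t))"
  unfolding continuous_on_iff
proof (intro ballI allI impI)
  fix t e :: real
  assume "t \<in> A" "e > 0"
  then obtain d where "d > 0" "\<forall>s\<in>A. dist s t < d \<longrightarrow> dist (f s) (f t) < e"
    using assms(2) unfolding continuous_on_iff by blast
  moreover have "dist (lmod x) (lmod y) \<le> dist x y" for x y :: 'x
    unfolding dist_norm by (rule banach_lattice_normD[OF assms(1) lmod_lmod_diff])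
  ultimately show "\<exists>d>0. \<forall>s\<in>A. dist s t < d \<longrightarrow> dist (lmod (f s)) (lmod (f t)) < e"
    by (meson order_le_less_trans)
qed

text \<open>The positive cone is closed: for \<open>y \<ge> 0\<close> the negative part of
  \<open>x\<close> lies below \<open>lmod (y - x)\<close>, so its norm is at most
  \<open>norm (y - x)\<close> and hence arbitrarily small.\<close>

lemma nonneg_if_approx:
  fixes x :: "'x::{banach,ordered_real_vector,lattice}"
  assumes "banach_lattice_X TYPE('x)"
    and approx: "\<And>e. e > 0 \<Longrightarrow> \<exists>y\<ge>0. norm (y - x) < e"
  shows "0 \<le> x"
proof -
  have "norm (sup (- x) 0) < e" if "e > 0" for e
  proof -
    obtain y where y: "0 \<le> y" "norm (y - x) < e"
      using approx[OF \<open>e > 0\<close>] by blast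
    have "- x \<le> lmod (y - x)"
      using y(1) lmod_ge(1)[of "y - x"] order_trans[of "- x" "y - x"] by simp
    then have "sup (- x) 0 \<le> lmod (y - x)"
      by (simp add: lmod_nonneg)
    then have "norm (sup (- x) 0) \<le> norm (lmod (y - x))"
      by (intro norm_mono_nonneg assms) auto
    then show ?thesis
      using y(2) norm_lmod[OF assms(1)] by simp
  qed
  then have "norm (sup (- x) 0) = 0"
    by (metis norm_ge_zero order_less_irrefl order_le_less)
  then have "- x \<le> 0"
    by (metis norm_eq_zero sup_ge1)
  then show ?thesis by simp
qed

lemma nonneg_tendsto:
  fixes f :: "'a \<Rightarrow> 'x::{banach,ordered_real_vector,lattice}"
  assumes "banach_lattice_X TYPE('x)" "(f \<longlongrightarrow> x) F" "F \<noteq> bot" "\<forall>\<^sub>F t in F. 0 \<le> f t"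
  shows "0 \<le> x"
proof (rule nonneg_if_approx[OF assms(1)])
  fix e :: real assume "e > 0"
  then have "\<forall>\<^sub>F t in F. norm (f t - x) < e"
    using tendstoD[OF assms(2)] by (simp add: dist_norm)
  then have "\<forall>\<^sub>F t in F. norm (f t - x) < e \<and> 0 \<le> f t"
    using assms(4) by eventually_elim auto
  then show "\<exists>y\<ge>0. norm (y - x) < e"
    using eventually_happens'[OF assms(3)] by blast
qed

text \<open>The integral is approximated by Riemann sums over gauge-fine divisions. These are sums
  of nonnegative terms, so closedness of the cone applies.\<close>

lemma integral_nonneg_banach_lattice:
  fixes f :: "real \<Rightarrow> 'x::{banach,ordered_real_vector,lattice}"
  assumes "banach_lattice_X TYPE('x)" "f integrable_on {a..b}" "\<And>t. t \<in> {a..b} \<Longrightarrow> 0 \<le> f t"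
  shows "0 \<le> integral {a..b} f"
proof (rule nonneg_if_approx[OF assms(1)])
  fix e :: real assume "e > 0"
  have "(f has_integral integral {a..b} f) (cbox a b)"
    using integrable_integral[OF assms(2)] by simp
  from this[unfolded has_integral, rule_format, OF \<open>e > 0\<close>]
  obtain g where g: "gauge g" "\<forall>p. p tagged_division_of cbox a b \<and> g fine p \<longrightarrow>
      norm ((\<Sum>(x,k)\<in>p. measure lborel k *\<^sub>R f x) - integral {a..b} f) < e"
    by (elim exE conjE)
  obtain p where p: "p tagged_division_of cbox a b" "g fine p"
    using fine_division_exists[OF g(1)] by blast
  have "0 \<le> (\<Sum>(x,k)\<in>p. measure lborel k *\<^sub>R f x)"
  proof (rule sum_nonneg, clarsimp)
    fix x k assume "(x, k) \<in> p"
    then have "x \<in> {a..b}"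
      using tagged_division_ofD(2,3)[OF p(1), of x k] by auto
    then show "0 \<le> measure lborel k *\<^sub>R f x"
      by (intro scaleR_nonneg_nonneg assms(3)) auto
  qed
  then show "\<exists>y\<ge>0. norm (y - integral {a..b} f) < e"
    using g(2) p by blast
qed

section \<open>Continuously embedded Banach spaces\<close>

locale embedded_banach =
  fixes Y :: "'x::banach set" and nY :: "'x \<Rightarrow> real"
  assumes embedded: "banach_embedded Y nY"
begin

lemma subspace_Y: "subspace Y"
  using embedded by (simp add: banach_embedded_def normed_subspace_def)

lemmas Y_add = subspace_add[OF subspace_Y]
  and Y_diff = subspace_diff[OF subspace_Y]
  and Y_scale = subspace_scale[OF subspace_Y]
  and Y_neg = subspace_neg[OF subspace_Y]
  and Y_0 = subspace_0[OF subspace_Y]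

lemma nY_nonneg: "y \<in> Y \<Longrightarrow> 0 \<le> nY y"
  and nY_eq_0: "y \<in> Y \<Longrightarrow> nY y = 0 \<longleftrightarrow> y = 0"
  and nY_scale: "y \<in> Y \<Longrightarrow> nY (a *\<^sub>R y) = \<bar>a\<bar> * nY y"
  and nY_triangle: "y \<in> Y \<Longrightarrow> z \<in> Y \<Longrightarrow> nY (y + z) \<le> nY y + nY z"
  using embedded by (simp_all add: banach_embedded_def normed_subspace_def)

lemma nY_0 [simp]: "nY 0 = 0"
  using nY_eq_0[OF Y_0] by simp

lemma nY_neg: "y \<in> Y \<Longrightarrow> nY (- y) = nY y"
  using nY_scale[of y "- 1"] by simp

lemma nY_commute: "y \<in> Y \<Longrightarrow> z \<in> Y \<Longrightarrow> nY (y - z) = nY (z - y)"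
  using nY_neg[OF Y_diff, of y z] by simp

lemma nY_triangle_diff: "x \<in> Y \<Longrightarrow> y \<in> Y \<Longrightarrow> z \<in> Y \<Longrightarrow> nY (x - z) \<le> nY (x - y) + nY (y - z)"
  using nY_triangle[OF Y_diff Y_diff, of x y y z] by simp

lemma nY_diff_ge: "y \<in> Y \<Longrightarrow> z \<in> Y \<Longrightarrow> \<bar>nY y - nY z\<bar> \<le> nY (y - z)"
  using nY_triangle[OF Y_diff, of y z z] nY_triangle[OF Y_diff, of z y y] nY_commute[of y z]
  by (auto simp: abs_le_iff)

definition embed_const :: real where
  "embed_const = (SOME C. C > 0 \<and> (\<forall>y\<in>Y. norm y \<le> C * nY y))"

lemma embed_const: "embed_const > 0" "y \<in> Y \<Longrightarrow> norm y \<le> embed_const * nY y"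
proof -
  obtain C where C: "\<forall>y\<in>Y. norm y \<le> C * nY y"
    using embedded by (auto simp: banach_embedded_def)
  have "\<exists>C. C > 0 \<and> (\<forall>y\<in>Y. norm y \<le> C * nY y)"
  proof (intro exI[of _ "max C 1"] conjI ballI)
    fix y assume y: "y \<in> Y"
    then have "norm y \<le> C * nY y" using C by blast
    also have "\<dots> \<le> max C 1 * nY y"
      using nY_nonneg[OF y] by (intro mult_right_mono) auto
    finally show "norm y \<le> max C 1 * nY y" .
  qed simp
  from someI_ex[OF this]
  show "embed_const > 0" "y \<in> Y \<Longrightarrow> norm y \<le> embed_const * nY y"
    unfolding embed_const_def[symmetric] by auto
qed

text \<open>The steps are dominated by a geometric series: from index \<open>n\<close> on they add
  up to at most \<open>r n + r n / 2 + r n / 4 + ...\<close>, that is \<open>2 * r n\<close>.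
  Completeness of \<open>Y\<close> then yields the limit, which inherits the bound.\<close>

lemma telescoping_limit:
  assumes s: "\<And>n. s n \<in> Y" and step: "\<And>n. nY (s (Suc n) - s n) \<le> r n"
    and half: "\<And>n. r (Suc n) \<le> r n / 2"
  obtains l where "l \<in> Y" "\<And>n. nY (l - s n) \<le> 2 * r n" "(\<lambda>n. nY (s n - l)) \<longlonglongrightarrow> 0"
proof -
  have r0: "0 \<le> r n" for n
    using order_trans[OF nY_nonneg[OF Y_diff[OF s s]] step] .
  \<comment> \<open>The subtracted term makes the induction close, because halving gives
    \<open>r (n + j) \<le> 2 * r (n + j) - 2 * r (n + Suc j)\<close>.\<close>
  have bound: "nY (s (n + j) - s n) \<le> 2 * r n - 2 * r (n + j)" for n j
  proof (induction j)
    case (Suc j)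
    have "nY (s (n + Suc j) - s n) \<le> nY (s (Suc (n + j)) - s (n + j)) + nY (s (n + j) - s n)"
      using nY_triangle_diff[OF s s s] by simp
    also have "\<dots> \<le> r (n + j) + (2 * r n - 2 * r (n + j))"
      using step Suc by (rule add_mono)
    finally show ?case
      using half[of "n + j"] by simp
  qed simp
  then have bound': "nY (s m - s n) \<le> 2 * r n" if "n \<le> m" for m n
    using r0[of m] bound[of n "m - n"] that by simp
  have "r n \<le> r 0 * (1/2) ^ n" for n
  proof (induction n)
    case (Suc n)
    then show ?case using half[of n] by simp
  qed simp
  moreover have "(\<lambda>n. r 0 * (1/2) ^ n) \<longlonglongrightarrow> r 0 * 0"
    by (intro tendsto_mult tendsto_const LIMSEQ_realpow_zero) auto
  ultimately have r_lim: "r \<longlonglongrightarrow> 0"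
    using r0 by (intro tendsto_sandwich[of "\<lambda>_. 0" r _ "\<lambda>n. r 0 * (1/2) ^ n"]) auto
  have "\<forall>e>0. \<exists>N. \<forall>m\<ge>N. \<forall>n\<ge>N. nY (s m - s n) < e"
  proof (intro allI impI)
    fix e :: real assume "e > 0"
    then have "\<forall>\<^sub>F n in sequentially. r n < e / 4"
      using r_lim by (intro order_tendstoD) auto
    then obtain N where N: "r N < e / 4"
      using eventually_happens' sequentially_bot by blast
    have "nY (s m - s n) < e" if "m \<ge> N" "n \<ge> N" for m n
    proof -
      have "nY (s m - s n) \<le> nY (s m - s N) + nY (s n - s N)"
        using nY_triangle_diff[OF s[of m] s[of N] s[of n]] nY_commute[OF s[of N] s[of n]] by simp
      then show ?thesis
        using bound'[OF that(1)] bound'[OF that(2)] N by simp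
    qed
    then show "\<exists>N. \<forall>m\<ge>N. \<forall>n\<ge>N. nY (s m - s n) < e" by blast
  qed
  then obtain l where l: "l \<in> Y" "(\<lambda>n. nY (s n - l)) \<longlonglongrightarrow> 0"
    using embedded s unfolding banach_embedded_def complete_wrt_def by blast
  have "nY (l - s n) \<le> 2 * r n" for n
  proof (rule tendsto_lowerbound)
    show "(\<lambda>m. 2 * r n + nY (s m - l)) \<longlonglongrightarrow> 2 * r n"
      using tendsto_add[OF tendsto_const l(2)] by simp
    show "\<forall>\<^sub>F m in sequentially. nY (l - s n) \<le> 2 * r n + nY (s m - l)"
      unfolding eventually_sequentially
      using bound'[of n] nY_triangle_diff[OF l(1) s s] nY_commute[OF l(1) s]
      by (smt (verit))
  qed simp
  with l that show ?thesis by blast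
qed

text \<open>Uniform boundedness by a gliding hump: \<open>x\<^sub>0 + x\<^sub>1 + \<dots>\<close> is built so that the \<open>n\<close>-th partial
  sum makes some seminorm exceed \<open>n\<close>, while the remaining terms are too small for that seminorm
  to notice.\<close>

lemma uniform_boundedness:
  fixes p :: "'i \<Rightarrow> 'x \<Rightarrow> real"
  assumes tri: "\<And>i x y. i \<in> I \<Longrightarrow> x \<in> Y \<Longrightarrow> y \<in> Y \<Longrightarrow> p i (x + y) \<le> p i x + p i y"
    and scale: "\<And>i x a. i \<in> I \<Longrightarrow> x \<in> Y \<Longrightarrow> p i (a *\<^sub>R x) = \<bar>a\<bar> * p i x"
    and cont: "\<And>i. i \<in> I \<Longrightarrow> \<exists>C. \<forall>x\<in>Y. p i x \<le> C * nY x"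
    and pointwise: "\<And>x. x \<in> Y \<Longrightarrow> \<exists>B. \<forall>i\<in>I. p i x \<le> B"
  shows "\<exists>M\<ge>0. \<forall>i\<in>I. \<forall>x\<in>Y. p i x \<le> M * nY x"
proof (rule ccontr)
  assume unbounded: "\<not> ?thesis"
  \<comment> \<open>If there were no hump near \<open>s\<close>, translation by \<open>- s\<close>
    would bound all seminorms on the ball of radius \<open>\<rho>\<close> about 0, and scaling would
    give the uniform bound that was denied.\<close>
  have hump: "\<exists>x\<in>Y. \<exists>i\<in>I. nY x \<le> \<rho> \<and> p i (s + x) > K" if "s \<in> Y" "\<rho> > 0" for s \<rho> K
  proof (rule ccontr)
    assume not_hump: "\<not> ?thesis"
    obtain B where B: "\<forall>i\<in>I. p i s \<le> B"
      using pointwise[OF \<open>s \<in> Y\<close>] by blast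
    have small: "p i x \<le> \<bar>K\<bar> + \<bar>B\<bar>" if i: "i \<in> I" and x: "x \<in> Y" "nY x \<le> \<rho>" for i x
    proof -
      have "p i (- s) = p i s"
        using scale[OF i \<open>s \<in> Y\<close>, of "- 1"] by simp
      moreover have "p i (s + x + - s) \<le> p i (s + x) + p i (- s)"
        using i x \<open>s \<in> Y\<close> by (intro tri Y_add Y_neg)
      moreover have "p i (s + x) \<le> K"
        using not_hump i x by force
      moreover have "p i s \<le> B" using B i by blast
      ultimately show ?thesis by simp
    qed
    have "p i x \<le> (\<bar>K\<bar> + \<bar>B\<bar>) / \<rho> * nY x" if i: "i \<in> I" and x: "x \<in> Y" for i x
    proof (cases "x = 0")
      case True
      then show ?thesis using scale[OF i x, of 0] by simp
    next
      case False
      then have pos: "nY x > 0"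
        using nY_nonneg[OF x] nY_eq_0[OF x] by simp
      have "p i ((\<rho> / nY x) *\<^sub>R x) \<le> \<bar>K\<bar> + \<bar>B\<bar>"
        using pos \<open>\<rho> > 0\<close> by (intro small i Y_scale x) (simp add: nY_scale x)
      then show ?thesis
        using pos \<open>\<rho> > 0\<close> by (simp add: scale i x field_simps)
    qed
    moreover have "0 \<le> (\<bar>K\<bar> + \<bar>B\<bar>) / \<rho>" using \<open>\<rho> > 0\<close> by simp
    ultimately show False using unbounded by blast
  qed
  define P where "P = (\<lambda>(n::nat) (s, \<rho>). s \<in> Y \<and> (\<rho>::real) > 0)"
  \<comment> \<open>The tail beyond \<open>s'\<close> will have norm at most
    \<open>2 * \<rho>'\<close>, so the chosen seminorm changes by at most 1 between
    \<open>s'\<close> and the limit. The threshold \<open>real n + 1\<close> thus leaves more than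
    \<open>n - 1 + 1\<close> at the limit.\<close>
  define Q where "Q = (\<lambda>(n::nat) (s, \<rho>) (s', \<rho>'). nY (s' - s) \<le> \<rho> \<and> \<rho>' \<le> \<rho> / 2 \<and>
      (\<exists>i\<in>I. p i s' > real n + 1 \<and> (\<forall>x\<in>Y. nY x \<le> 2 * \<rho>' \<longrightarrow> p i x \<le> 1)))"
  have "\<exists>f. \<forall>n. P n (f n) \<and> Q n (f n) (f (Suc n))"
  proof (rule dependent_nat_choice)
    show "\<exists>z. P 0 z"
      using Y_0 by (intro exI[of _ "(0, 1)"]) (simp add: P_def)
  next
    fix z and n :: nat
    assume "P n z"
    then obtain s \<rho> where z: "z = (s, \<rho>)" "s \<in> Y" "\<rho> > 0" by (auto simp: P_def)
    obtain x i where x: "x \<in> Y" "i \<in> I" "nY x \<le> \<rho>" "p i (s + x) > real n + 1"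
      using hump[OF z(2,3)] by blast
    obtain C where C: "\<forall>x\<in>Y. p i x \<le> C * nY x"
      using cont[OF x(2)] by blast
    \<comment> \<open>The first entry ensures geometric decay; the second turns the continuity
      constant \<open>C\<close> of the chosen seminorm into the bound 1 on the ball of radius
      \<open>2 * \<rho>'\<close>.\<close>
    define \<rho>' where "\<rho>' = min (\<rho> / 2) (1 / (2 * (\<bar>C\<bar> + 1)))"
    have "p i y \<le> 1" if y: "y \<in> Y" "nY y \<le> 2 * \<rho>'" for y
    proof -
      have "p i y \<le> C * nY y" using C y by blast
      also have "\<dots> \<le> (\<bar>C\<bar> + 1) * nY y"
        using nY_nonneg[OF y(1)] by (intro mult_right_mono) auto
      also have "\<dots> \<le> (\<bar>C\<bar> + 1) * (2 * (1 / (2 * (\<bar>C\<bar> + 1))))"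
        using y(2) by (intro mult_left_mono) (auto simp: \<rho>'_def)
      also have "\<dots> = 1" by (simp add: field_simps)
      finally show ?thesis .
    qed
    moreover have "\<rho>' > 0" using z(3) by (simp add: \<rho>'_def add_nonneg_pos)
    moreover have "\<rho>' \<le> \<rho> / 2" by (simp add: \<rho>'_def)
    ultimately have "P (Suc n) (s + x, \<rho>') \<and> Q n z (s + x, \<rho>')"
      using x z Y_add[OF z(2) x(1)] by (auto simp: P_def Q_def)
    then show "\<exists>z'. P (Suc n) z' \<and> Q n z z'" by blast
  qed
  then obtain f where f: "\<And>n. P n (f n)" "\<And>n. Q n (f n) (f (Suc n))" by blast
  define s \<rho> where "s = fst \<circ> f" and "\<rho> = snd \<circ> f"
  have s: "s n \<in> Y" "nY (s (Suc n) - s n) \<le> \<rho> n" "\<rho> (Suc n) \<le> \<rho> n / 2"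
    and i: "\<exists>i\<in>I. p i (s (Suc n)) > real n + 1 \<and> (\<forall>x\<in>Y. nY x \<le> 2 * \<rho> (Suc n) \<longrightarrow> p i x \<le> 1)" for n
    using f(1)[of n] f(2)[of n] by (auto simp: P_def Q_def s_def \<rho>_def split_beta)
  obtain l where l: "l \<in> Y" "\<And>n. nY (l - s n) \<le> 2 * \<rho> n"
    using telescoping_limit[of s \<rho>] s by metis
  obtain B where B: "\<forall>i\<in>I. p i l \<le> B"
    using pointwise[OF l(1)] by blast
  obtain n :: nat where n: "B < real n"
    using reals_Archimedean2 by blast
  obtain i where i: "i \<in> I" "p i (s (Suc n)) > real n + 1" "\<forall>x\<in>Y. nY x \<le> 2 * \<rho> (Suc n) \<longrightarrow> p i x \<le> 1"
    using i by blast
  have "nY (s (Suc n) - l) \<le> 2 * \<rho> (Suc n)"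
    using l(2) nY_commute[OF l(1) s(1)] by metis
  then have "p i (s (Suc n) - l) \<le> 1"
    using i(3) Y_diff[OF s(1) l(1)] by blast
  moreover have "p i (l + (s (Suc n) - l)) \<le> p i l + p i (s (Suc n) - l)"
    by (intro tri i(1) l(1) Y_diff s(1))
  moreover have "p i l \<le> B" using B i(1) by blast
  ultimately show False using i(2) n by simp
qed

section \<open>Continuity with respect to the norm of \<open>Y\<close>\<close>

lemma Ycontinuous_onD:
  assumes "Ycontinuous_on nY A u" "t \<in> A" "e > 0"
  obtains d where "d > 0" "\<And>s. s \<in> A \<Longrightarrow> \<bar>s - t\<bar> < d \<Longrightarrow> nY (u s - u t) < e"
  using assms unfolding Ycontinuous_on_def by blast

lemma Ycontinuous_on_subset: "Ycontinuous_on nY A u \<Longrightarrow> B \<subseteq> A \<Longrightarrow> Ycontinuous_on nY B u"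
  unfolding Ycontinuous_on_def by (meson subsetD)

lemma Ycontinuous_on_dominated:
  assumes u: "Ycontinuous_on nY A u"
    and v: "\<And>s t. s \<in> A \<Longrightarrow> t \<in> A \<Longrightarrow> nY (v s - v t) \<le> nY (u s - u t)"
  shows "Ycontinuous_on nY A v"
  unfolding Ycontinuous_on_def
proof (intro ballI allI impI)
  fix t e :: real assume t: "t \<in> A" and "e > 0"
  then obtain d where "d > 0" "\<And>s. s \<in> A \<Longrightarrow> \<bar>s - t\<bar> < d \<Longrightarrow> nY (u s - u t) < e"
    using Ycontinuous_onD[OF u] by metis
  then show "\<exists>d>0. \<forall>s\<in>A. \<bar>s - t\<bar> < d \<longrightarrow> nY (v s - v t) < e"
    using v[OF _ t] by (intro exI[of _ d]) (auto intro: order_le_less_trans)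
qed

text \<open>One transfer principle for three maps along a \<open>Y\<close>-continuous curve: the
  embedding into \<open>X\<close>, the norm \<open>nY\<close>, and later the operator
  \<open>H\<close>.\<close>

lemma continuous_on_dominated_by_nY:
  fixes g :: "real \<Rightarrow> 'b::metric_space"
  assumes u: "Ycontinuous_on nY A u" "\<And>t. t \<in> A \<Longrightarrow> u t \<in> Y"
    and g: "\<And>s t. s \<in> A \<Longrightarrow> t \<in> A \<Longrightarrow> dist (g s) (g t) \<le> C * nY (u s - u t)"
  shows "continuous_on A g"
  unfolding continuous_on_iff
proof (intro ballI allI impI)
  fix t e :: real assume te: "t \<in> A" "e > 0"
  then obtain d where d: "d > 0" "\<And>s. s \<in> A \<Longrightarrow> \<bar>s - t\<bar> < d \<Longrightarrow> nY (u s - u t) < e / (\<bar>C\<bar> + 1)"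
    using Ycontinuous_onD[OF u(1), of t "e / (\<bar>C\<bar> + 1)"] by (auto simp: add_nonneg_pos)
  have "dist (g s) (g t) < e" if s: "s \<in> A" "dist s t < d" for s
  proof -
    have "dist (g s) (g t) \<le> C * nY (u s - u t)" using g s te by blast
    also have "\<dots> \<le> (\<bar>C\<bar> + 1) * nY (u s - u t)"
      using nY_nonneg[OF Y_diff[OF u(2) u(2)]] s te by (intro mult_right_mono) auto
    also have "\<dots> < (\<bar>C\<bar> + 1) * (e / (\<bar>C\<bar> + 1))"
      using d(2)[of s] s by (intro mult_strict_left_mono) (auto simp: dist_real_def)
    also have "\<dots> = e" by simp
    finally show ?thesis .
  qed
  then show "\<exists>d>0. \<forall>s\<in>A. dist s t < d \<longrightarrow> dist (g s) (g t) < e" using d(1) by blast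
qed

lemma Ycontinuous_imp_continuous_on:
  assumes "Ycontinuous_on nY A u" "\<And>t. t \<in> A \<Longrightarrow> u t \<in> Y"
  shows "continuous_on A u"
  using assms embed_const(2)[OF Y_diff]
  by (intro continuous_on_dominated_by_nY[of A u u embed_const]) (auto simp: dist_norm)

lemma Ycontinuous_imp_continuous_on_nY:
  assumes "Ycontinuous_on nY A u" "\<And>t. t \<in> A \<Longrightarrow> u t \<in> Y"
  shows "continuous_on A (\<lambda>t. nY (u t))"
  using assms nY_diff_ge
  by (intro continuous_on_dominated_by_nY[of A u _ 1]) (auto simp: dist_real_def)

lemma Ycontinuous_bounded:
  assumes "Ycontinuous_on nY {a..b} u" "\<And>t. t \<in> {a..b} \<Longrightarrow> u t \<in> Y"
  obtains B where "B > 0" "\<And>t. t \<in> {a..b} \<Longrightarrow> nY (u t) \<le> B"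
proof -
  have "bounded ((\<lambda>t. nY (u t)) ` {a..b})"
    using assms by (intro compact_imp_bounded compact_continuous_image
        Ycontinuous_imp_continuous_on_nY) auto
  then obtain B where "B > 0" "\<forall>x\<in>(\<lambda>t. nY (u t)) ` {a..b}. norm x \<le> B"
    using bounded_pos by blast
  then show ?thesis by (intro that[of B]) (auto simp: abs_le_iff)
qed

end

text \<open>Automatic continuity of positive operators. Otherwise there are positive
  \<open>y n\<close> in the unit ball of \<open>Y\<close> with
  \<open>norm (H (y n)) \<ge> 4 ^ n\<close>; the sum \<open>l\<close> of the series of
  \<open>(1/2) ^ n *\<^sub>R y n\<close> dominates each term, and monotonicity forces
  \<open>norm (H l) \<ge> 2 ^ k\<close> for every \<open>k\<close>.\<close>

lemma positive_operator_bounded: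
  fixes Y :: "'x::{banach,ordered_real_vector,lattice} set"
  assumes XY: "banach_embedded Y nY" and X_lat: "banach_lattice_X TYPE('x)"
    and Y_lat: "banach_sublattice Y nY"
    and lin: "\<forall>y\<in>Y. \<forall>z\<in>Y. \<forall>a b. H (a *\<^sub>R y + b *\<^sub>R z) = a *\<^sub>R H y + b *\<^sub>R H z"
    and pos: "\<forall>y\<in>Y. 0 \<le> y \<longrightarrow> 0 \<le> (H y :: 'x)"
  shows "\<exists>K>0. \<forall>y\<in>Y. norm (H y) \<le> K * nY y"
proof (rule ccontr)
  interpret embedded_banach Y nY by unfold_locales (rule XY)
  assume unbounded: "\<not> ?thesis"
  have H_scale: "H (a *\<^sub>R y) = a *\<^sub>R H y" if "y \<in> Y" for a y
    using lin[rule_format, OF that that, of a 0] by simp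
  have H_diff: "H (y - z) = H y - H z" if "y \<in> Y" "z \<in> Y" for y z
    using lin[rule_format, OF that, of 1 "- 1"] by simp
  have H_mono: "H y \<le> H z" if "y \<in> Y" "z \<in> Y" "y \<le> z" for y z
    using pos Y_diff[of z y] H_diff[of z y] that by force
  have lmod_Y: "lmod y \<in> Y" if "y \<in> Y" for y
    using that Y_neg Y_lat by (auto simp: banach_sublattice_def lmod_def)
  have "\<exists>y\<in>Y. 0 \<le> y \<and> nY y \<le> 1 \<and> 4 ^ n \<le> norm (H y)" for n :: nat
  proof -
    obtain y where y: "y \<in> Y" "norm (H y) > 4 ^ n * nY y"
      using unbounded by (meson not_less zero_less_numeral zero_less_power)
    have "y \<noteq> 0"
      using y H_scale[OF Y_0, of 0] by auto
    then have ny: "nY y > 0" using nY_nonneg[OF y(1)] nY_eq_0[OF y(1)] by simp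
    have eq: "nY (lmod y) \<le> nY y"
      using Y_lat y(1) lmod_Y[OF y(1)] lmod_of_nonneg[OF lmod_nonneg[of y]]
      by (auto simp: banach_sublattice_def)
    have "- H y = H (- y)"
      using H_scale[OF y(1), of "- 1"] by simp
    \<comment> \<open>This passes from \<open>y\<close> to the positive element
      \<open>lmod y\<close> without decreasing the norm of the image; the norm of the argument does
      not grow, by \<open>eq\<close>.\<close>
    then have "lmod (H y) \<le> H (lmod y)"
      using y(1) by (intro lmod_least) (auto intro!: H_mono lmod_Y Y_neg lmod_ge)
    then have "norm (H y) \<le> norm (H (lmod y))"
      using norm_mono_nonneg[OF X_lat lmod_nonneg] norm_lmod[OF X_lat] by metis
    then have "4 ^ n * nY y \<le> norm (H (lmod y))"
      using y(2) by simp
    then have "4 ^ n \<le> norm (H ((1 / nY y) *\<^sub>R lmod y))"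
      using ny by (simp add: H_scale lmod_Y y(1) field_simps)
    moreover have "nY ((1 / nY y) *\<^sub>R lmod y) \<le> 1"
      using eq ny by (simp add: nY_scale lmod_Y y(1))
    moreover have "0 \<le> (1 / nY y) *\<^sub>R lmod y"
      using ny lmod_nonneg by (intro scaleR_nonneg_nonneg) auto
    ultimately show ?thesis
      using Y_scale[OF lmod_Y[OF y(1)]] by blast
  qed
  then obtain y where y: "\<And>n::nat. y n \<in> Y" "\<And>n. 0 \<le> y n" "\<And>n. nY (y n) \<le> 1"
      "\<And>n. 4 ^ n \<le> norm (H (y n))"
    by metis
  define s where "s n = (\<Sum>k<n. (1/2) ^ k *\<^sub>R y k)" for n
  have s_Y: "s n \<in> Y" for n
    unfolding s_def by (intro subspace_sum[OF subspace_Y] Y_scale y)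
  obtain l where l: "l \<in> Y" "(\<lambda>n. nY (s n - l)) \<longlonglongrightarrow> 0"
  proof (rule telescoping_limit[of s "\<lambda>n. (1/2) ^ n"])
    show "nY (s (Suc n) - s n) \<le> (1/2) ^ n" for n
      using y(3)[of n] by (simp add: s_def nY_scale y(1) field_simps)
  qed (use s_Y in auto)
  \<comment> \<open>Closedness of the cone is available for the norm of \<open>X\<close>, so the
    convergence in \<open>Y\<close> is first carried over to \<open>X\<close>.\<close>
  have s_lim: "s \<longlonglongrightarrow> l"
  proof (rule LIM_zero_cancel, rule Lim_null_comparison)
    show "(\<lambda>n. embed_const * nY (s n - l)) \<longlonglongrightarrow> 0"
      using tendsto_mult_right_zero[OF l(2)] .
    show "\<forall>\<^sub>F n in sequentially. norm (s n - l) \<le> embed_const * nY (s n - l)"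
      using embed_const(2)[OF Y_diff[OF s_Y l(1)]] by simp
  qed
  have "2 ^ k \<le> norm (H l)" for k
  proof -
    have "0 \<le> l - (1/2) ^ k *\<^sub>R y k"
    proof (rule nonneg_tendsto[OF X_lat tendsto_diff[OF s_lim tendsto_const]])
      have "(1/2) ^ k *\<^sub>R y k \<le> s n" if "n > k" for n
        unfolding s_def using that y(2)
          sum_mono2[of "{..<n}" "{k}" "\<lambda>k. (1/2) ^ k *\<^sub>R y k"]
        by (simp add: scaleR_nonneg_nonneg)
      then show "\<forall>\<^sub>F n in sequentially. 0 \<le> s n - (1/2) ^ k *\<^sub>R y k"
        unfolding eventually_sequentially by (intro exI[of _ "Suc k"]) auto
    qed simp
    then have "(1/2) ^ k *\<^sub>R H (y k) \<le> H l"
      using H_mono[OF Y_scale[OF y(1)] l(1), of "(1/2) ^ k" k] by (simp add: H_scale y(1))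
    moreover have "0 \<le> (1/2) ^ k *\<^sub>R H (y k)"
      using pos y by (intro scaleR_nonneg_nonneg) auto
    ultimately have "norm ((1/2) ^ k *\<^sub>R H (y k)) \<le> norm (H l)"
      using norm_mono_nonneg[OF X_lat] by blast
    moreover have "(1/2) ^ k * 4 ^ k \<le> norm ((1/2) ^ k *\<^sub>R H (y k))"
      using y(4)[of k] by simp
    moreover have "(1/2 :: real) ^ k * 4 ^ k = 2 ^ k"
      by (simp flip: power_mult_distrib)
    ultimately show ?thesis by linarith
  qed
  moreover obtain k where "norm (H l) < 2 ^ k"
    using real_arch_pow[of 2 "norm (H l)"] by auto
  ultimately show False
    by (simp add: leD)
qed

section \<open>Strongly continuous semigroups\<close>

text \<open>Regarding \<open>X\<close> as embedded in itself makes the uniform boundedness principle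
  available for seminorms on \<open>X\<close> as well.\<close>

lemma embedded_banach_UNIV: "embedded_banach (UNIV :: 'x::banach set) norm"
proof
  have "complete_wrt (UNIV :: 'x set) norm"
    unfolding complete_wrt_def
  proof (intro allI impI)
    fix f :: "nat \<Rightarrow> 'x"
    assume "\<forall>e>0. \<exists>N. \<forall>m\<ge>N. \<forall>n\<ge>N. norm (f m - f n) < e"
    then have "Cauchy f"
      by (intro CauchyI) auto
    then obtain l where "f \<longlonglongrightarrow> l"
      using Cauchy_convergent_iff convergent_def by blast
    then show "\<exists>l\<in>UNIV. (\<lambda>n. norm (f n - l)) \<longlonglongrightarrow> 0"
      using LIM_zero tendsto_norm_zero by blast
  qed
  then show "banach_embedded (UNIV :: 'x set) norm"
    by (auto simp: banach_embedded_def normed_subspace_def norm_triangle_ineq intro!: exI[of _ 1])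
qed

lemma C0_semigroup_bounded_linear: "C0_semigroup S \<Longrightarrow> 0 \<le> t \<Longrightarrow> bounded_linear (S t)"
  by (simp add: C0_semigroup_def)

lemma C0_semigroup_zero: "C0_semigroup S \<Longrightarrow> S 0 x = x"
  by (simp add: C0_semigroup_def)

lemma C0_semigroup_add: "C0_semigroup S \<Longrightarrow> 0 \<le> t \<Longrightarrow> 0 \<le> s \<Longrightarrow> S (t + s) x = S t (S s x)"
  by (simp add: C0_semigroup_def)

lemma C0_semigroup_continuous: "C0_semigroup S \<Longrightarrow> continuous_on {0..} (\<lambda>t. S t x)"
  by (simp add: C0_semigroup_def)

text \<open>Orbits over \<open>{0..b}\<close> are compact, hence bounded, so uniform boundedness
  applies to the seminorms \<open>\<lambda>x. norm (S t x)\<close>.\<close>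

lemma C0_semigroup_locally_bounded:
  fixes S :: "real \<Rightarrow> 'x::banach op"
  assumes S: "C0_semigroup S"
  obtains M where "M > 0" "\<And>t x. 0 \<le> t \<Longrightarrow> t \<le> b \<Longrightarrow> norm (S t x) \<le> M * norm x"
proof -
  interpret X: embedded_banach "UNIV :: 'x set" norm
    by (rule embedded_banach_UNIV)
  have "\<exists>M\<ge>0. \<forall>t\<in>{0..b}. \<forall>x\<in>UNIV. norm (S t x) \<le> M * norm x"
  proof (rule X.uniform_boundedness)
    fix t assume "t \<in> {0..b}"
    then interpret bounded_linear "S t"
      using S by (intro C0_semigroup_bounded_linear) auto
    show "norm (S t (x + y)) \<le> norm (S t x) + norm (S t y)" for x y
      by (simp add: add norm_triangle_ineq)
    show "norm (S t (a *\<^sub>R x)) = \<bar>a\<bar> * norm (S t x)" for a x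
      by (simp add: scale)
    show "\<exists>C. \<forall>x\<in>UNIV. norm (S t x) \<le> C * norm x"
      using bounded by (auto simp: mult.commute)
  next
    fix x
    have "bounded ((\<lambda>t. S t x) ` {0..b})"
      using continuous_on_subset[OF C0_semigroup_continuous[OF S]]
      by (intro compact_imp_bounded compact_continuous_image) auto
    then show "\<exists>B. \<forall>t\<in>{0..b}. norm (S t x) \<le> B"
      by (auto simp: bounded_iff)
  qed
  then obtain M where M: "M \<ge> 0" "\<forall>t\<in>{0..b}. \<forall>x. norm (S t x) \<le> M * norm x" by auto
  have "norm (S t x) \<le> (M + 1) * norm x" if "0 \<le> t" "t \<le> b" for t x
  proof -
    have "norm (S t x) \<le> M * norm x" using M that by simp
    also have "\<dots> \<le> (M + 1) * norm x" by (intro mult_right_mono) auto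
    finally show ?thesis .
  qed
  then show ?thesis using M(1) by (intro that[of "M + 1"]) auto
qed

text \<open>Joint continuity: the local operator bound absorbs the change of the argument, strong
  continuity the change of time.\<close>

lemma tendsto_C0_semigroup:
  fixes S :: "real \<Rightarrow> 'x::banach op"
  assumes S: "C0_semigroup S" and r: "(r \<longlongrightarrow> r0) F" "\<forall>\<^sub>F i in F. 0 \<le> r i" "0 \<le> r0"
    and \<phi>: "(\<phi> \<longlongrightarrow> x) F"
  shows "((\<lambda>i. S (r i) (\<phi> i)) \<longlongrightarrow> S r0 x) F"
proof -
  obtain M where M: "M > 0" "\<And>t y. 0 \<le> t \<Longrightarrow> t \<le> r0 + 1 \<Longrightarrow> norm (S t y) \<le> M * norm y"
    using C0_semigroup_locally_bounded[OF S] by blast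
  have "\<forall>\<^sub>F i in F. r i < r0 + 1"
    using r(1) by (rule order_tendstoD) simp
  then have "\<forall>\<^sub>F i in F. norm (S (r i) (\<phi> i) - S (r i) x) \<le> M * norm (\<phi> i - x)"
    using r(2)
  proof eventually_elim
    case (elim i)
    then show ?case
      using M(2)[of "r i" "\<phi> i - x"] linear_diff[of "S (r i)" "\<phi> i" x]
        bounded_linear.linear[OF C0_semigroup_bounded_linear[OF S]] by simp
  qed
  moreover have "((\<lambda>i. M * norm (\<phi> i - x)) \<longlongrightarrow> 0) F"
    using tendsto_mult_right_zero[OF tendsto_norm_zero[OF LIM_zero[OF \<phi>]]] .
  ultimately have "((\<lambda>i. S (r i) (\<phi> i) - S (r i) x) \<longlongrightarrow> 0) F"
    by (rule Lim_null_comparison)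
  moreover have "((\<lambda>i. S (r i) x) \<longlongrightarrow> S r0 x) F"
    using continuous_on_tendsto_compose[OF C0_semigroup_continuous[OF S] r(1)] r(2,3) by simp
  ultimately show ?thesis
    using tendsto_add by fastforce
qed

lemma continuous_on_C0_semigroup:
  fixes S :: "real \<Rightarrow> 'x::banach op"
  assumes S: "C0_semigroup S" and r: "continuous_on A r" "\<And>i. i \<in> A \<Longrightarrow> 0 \<le> r i"
    and \<phi>: "continuous_on A \<phi>"
  shows "continuous_on A (\<lambda>i. S (r i) (\<phi> i))"
  unfolding continuous_on_def
proof
  fix i assume i: "i \<in> A"
  have "\<forall>\<^sub>F j in at i within A. 0 \<le> r j"
    unfolding eventually_at_filter using r(2) by simp
  then show "((\<lambda>i. S (r i) (\<phi> i)) \<longlongrightarrow> S (r i) (\<phi> i)) (at i within A)"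
    using r \<phi> i unfolding continuous_on_def by (intro tendsto_C0_semigroup[OF S]) auto
qed

lemma continuous_on_C0_convolution:
  fixes S :: "real \<Rightarrow> 'x::banach op"
  assumes "C0_semigroup S" "continuous_on {a..b} f"
  shows "continuous_on {a..b} (\<lambda>s. S (b - s) (f s))"
  by (rule continuous_on_C0_semigroup) (use assms in \<open>auto intro: continuous_intros\<close>)

text \<open>\<open>S t\<close> commutes with \<open>S h\<close>, so it maps the difference quotient
  at \<open>x\<close> to the one at \<open>S t x\<close>.\<close>

lemma generates_invariant:
  assumes "generates D A S" "x \<in> D" "0 \<le> t"
  shows "S t x \<in> D"
proof -
  have S: "C0_semigroup S"
    and lim: "((\<lambda>h. (1 / h) *\<^sub>R (S h x - x)) \<longlongrightarrow> A x) (at_right 0)"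
    and D: "\<And>y v. ((\<lambda>h. (1 / h) *\<^sub>R (S h y - y)) \<longlongrightarrow> v) (at_right 0) \<Longrightarrow> y \<in> D"
    using assms unfolding generates_def by blast+
  interpret bounded_linear "S t"
    using C0_semigroup_bounded_linear[OF S \<open>0 \<le> t\<close>] .
  have "((\<lambda>h. S t ((1 / h) *\<^sub>R (S h x - x))) \<longlongrightarrow> S t (A x)) (at_right 0)"
    by (rule tendsto[OF lim])
  moreover have "\<forall>\<^sub>F h in at_right 0. S t ((1 / h) *\<^sub>R (S h x - x)) = (1 / h) *\<^sub>R (S h (S t x) - S t x)"
    using eventually_at_right_real[OF zero_less_one]
  proof eventually_elim
    case (elim h)
    then show ?case
      using C0_semigroup_add[OF S, of h t x] C0_semigroup_add[OF S, of t h x] \<open>0 \<le> t\<close>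
      by (simp add: scale diff add.commute)
  qed
  ultimately have "((\<lambda>h. (1 / h) *\<^sub>R (S h (S t x) - S t x)) \<longlongrightarrow> S t (A x)) (at_right 0)"
    by (rule Lim_transform_eventually)
  then show ?thesis by (rule D)
qed

text \<open>By joint continuity of \<open>(t, r) \<mapsto> S t (f r)\<close> at
  \<open>(0, s)\<close> the integrand is uniformly close to \<open>f s\<close>. This supplies the
  inhomogeneous part of the right derivative of a mild solution.\<close>

lemma C0_semigroup_average_tendsto:
  fixes S :: "real \<Rightarrow> 'x::banach op"
  assumes S: "C0_semigroup S" and f: "continuous_on {a..b} f" and s: "a \<le> s" "s < b"
  shows "((\<lambda>h. (1 / h) *\<^sub>R integral {s..s + h} (\<lambda>r. S (s + h - r) (f r))) \<longlongrightarrow> f s) (at_right 0)"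
proof (rule tendstoI)
  fix e :: real assume e: "e > 0"
  have "continuous_on ({0..} \<times> {a..b}) (\<lambda>z. S (fst z) (f (snd z)))"
    by (intro continuous_on_C0_semigroup[OF S] continuous_intros continuous_on_compose2[OF f]) auto
  then obtain d where d: "d > 0" "\<And>z. z \<in> {0..} \<times> {a..b} \<Longrightarrow> dist z (0, s) < d \<Longrightarrow>
      dist (S (fst z) (f (snd z))) (S 0 (f s)) < e / 2"
    unfolding continuous_on_iff by (elim ballE[of _ _ "(0, s)"] allE[of _ "e / 2"]) (use s e in auto)
  \<comment> \<open>Both coordinates of \<open>(s + h - r, r)\<close> differ from those of
    \<open>(0, s)\<close> by at most \<open>h\<close>, so \<open>h < d / 2\<close> keeps the pair
    within distance \<open>d\<close>.\<close>
  have "\<forall>\<^sub>F h in at_right 0. h \<in> {0<..<min (d / 2) (b - s)}"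
    using d(1) s by (intro eventually_at_right_real) auto
  then show "\<forall>\<^sub>F h in at_right 0. dist ((1 / h) *\<^sub>R integral {s..s + h} (\<lambda>r. S (s + h - r) (f r))) (f s) < e"
  proof eventually_elim
    case (elim h)
    let ?g = "\<lambda>r. S (s + h - r) (f r)"
    have g: "continuous_on {s..s + h} ?g"
      using elim s by (intro continuous_on_C0_convolution[OF S] continuous_on_subset[OF f]) auto
    have "norm (integral {s..s + h} (\<lambda>r. ?g r - f s)) \<le> e / 2 * (s + h - s)"
    proof (rule integral_bound)
      show "continuous_on {s..s + h} (\<lambda>r. ?g r - f s)"
        using g by (intro continuous_intros)
      fix r assume r: "r \<in> {s..s + h}"
      have "dist (s + h - r, r) (0, s) \<le> \<bar>s + h - r\<bar> + \<bar>r - s\<bar>"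
        unfolding dist_Pair_Pair dist_real_def by (simp add: sqrt_sum_squares_le_sum_abs)
      then show "norm (?g r - f s) \<le> e / 2"
        using d(2)[of "(s + h - r, r)"] r elim s
        by (simp add: dist_norm C0_semigroup_zero[OF S])
    qed (use elim in auto)
    moreover have "integral {s..s + h} (\<lambda>r. ?g r - f s) = integral {s..s + h} ?g - h *\<^sub>R f s"
      using elim by (subst integral_diff) (auto intro: integrable_continuous_real g)
    ultimately have "norm (integral {s..s + h} ?g - h *\<^sub>R f s) \<le> e / 2 * h" by simp
    moreover have "(1 / h) *\<^sub>R integral {s..s + h} ?g - f s = (1 / h) *\<^sub>R (integral {s..s + h} ?g - h *\<^sub>R f s)"
      using elim by (simp add: scaleR_diff_right)
    ultimately have "norm ((1 / h) *\<^sub>R integral {s..s + h} ?g - f s) \<le> e / 2"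
      using elim by (simp only: norm_scaleR) (simp add: field_simps)
    then show ?case using e by (simp add: dist_norm)
  qed
qed

lemma integral_right_derivative:
  fixes f :: "real \<Rightarrow> 'x::banach"
  assumes f: "continuous_on {a..b} f" and s: "a \<le> s" "s < b"
  shows "((\<lambda>h. (1 / h) *\<^sub>R (integral {a..s + h} f - integral {a..s} f)) \<longlongrightarrow> f s) (at_right 0)"
proof -
  have small: "\<forall>\<^sub>F h in at_right 0. h \<in> {0<..<b - s}"
    using s by (intro eventually_at_right_real) auto
  \<comment> \<open>The constant identity semigroup turns the convolution average into an ordinary
    one.\<close>
  have "C0_semigroup (\<lambda>_. id :: 'x \<Rightarrow> 'x)"
    by (simp add: C0_semigroup_def bounded_linear_ident[folded id_def])
  from C0_semigroup_average_tendsto[OF this f s]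
  have "((\<lambda>h. (1 / h) *\<^sub>R integral {s..s + h} f) \<longlongrightarrow> f s) (at_right 0)" by simp
  moreover have "\<forall>\<^sub>F h in at_right 0. (1 / h) *\<^sub>R integral {s..s + h} f
      = (1 / h) *\<^sub>R (integral {a..s + h} f - integral {a..s} f)"
    using small
  proof eventually_elim
    case (elim h)
    have "integral {a..s} f + integral {s..s + h} f = integral {a..s + h} f"
      using elim s f by (intro Henstock_Kurzweil_Integration.integral_combine
          integrable_continuous_real continuous_on_subset[OF f]) auto
    then show ?case by (metis add_diff_cancel_left')
  qed
  ultimately show ?thesis
    by (rule Lim_transform_eventually)
qed

text \<open>Mean value inequality for one-sided derivatives, the kind that generators provide. With
  slack \<open>\<epsilon>\<close>, the times satisfying the bound form a closed set, and at a
  supremum below \<open>b\<close> the right derivative would extend the bound further.\<close>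

lemma right_derivative_bound:
  fixes q :: "real \<Rightarrow> 'a::real_normed_vector"
  assumes b: "0 \<le> b" and cont: "continuous_on {0..b} q"
    and deriv: "\<And>s. 0 \<le> s \<Longrightarrow> s < b \<Longrightarrow> ((\<lambda>h. (1 / h) *\<^sub>R (q (s + h) - q s)) \<longlongrightarrow> q' s) (at_right 0)"
    and bound: "\<And>s. 0 \<le> s \<Longrightarrow> s < b \<Longrightarrow> norm (q' s) \<le> K"
  shows "norm (q b - q 0) \<le> K * b"
proof -
  have *: "norm (q b - q 0) \<le> (K + \<epsilon>) * b" if \<epsilon>: "\<epsilon> > 0" for \<epsilon>
  proof -
    define A where "A = {t \<in> {0..b}. norm (q t - q 0) \<le> (K + \<epsilon>) * t}"
    have "closed A"
      unfolding A_def by (intro continuous_on_closed_Collect_le continuous_intros cont)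
    moreover have "0 \<in> A" using b by (simp add: A_def)
    moreover have bdd: "bdd_above A" unfolding A_def by (intro bdd_aboveI[of _ b]) auto
    ultimately have SupA: "Sup A \<in> A"
      by (intro closed_contains_Sup) auto
    define c where "c = Sup A"
    have c: "0 \<le> c" "c \<le> b" "norm (q c - q 0) \<le> (K + \<epsilon>) * c"
      using SupA by (auto simp: A_def c_def)
    have "c = b"
    proof (rule ccontr)
      assume "c \<noteq> b"
      with c have cb: "c < b" by simp
      have "((\<lambda>h. norm ((1 / h) *\<^sub>R (q (c + h) - q c))) \<longlongrightarrow> norm (q' c)) (at_right 0)"
        by (intro tendsto_norm deriv c cb)
      then have "\<forall>\<^sub>F h in at_right 0. norm ((1 / h) *\<^sub>R (q (c + h) - q c)) < K + \<epsilon>"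
        using bound[OF c(1) cb] \<epsilon> by (intro order_tendstoD) auto
      moreover have "\<forall>\<^sub>F h in at_right 0. h \<in> {0<..<b - c}"
        using cb by (intro eventually_at_right_real) auto
      ultimately have "\<forall>\<^sub>F h in at_right 0. h \<in> {0<..<b - c} \<and>
          norm ((1 / h) *\<^sub>R (q (c + h) - q c)) < K + \<epsilon>"
        by eventually_elim auto
      then obtain h where h: "0 < h" "h < b - c" "norm ((1 / h) *\<^sub>R (q (c + h) - q c)) < K + \<epsilon>"
        using eventually_happens'[OF trivial_limit_at_right_real] by force
      have "norm (q (c + h) - q c) \<le> (K + \<epsilon>) * h"
        using h by (simp only: norm_scaleR) (simp add: field_simps)
      then have "norm (q (c + h) - q 0) \<le> (K + \<epsilon>) * (c + h)"
        using c(3) norm_triangle_ineq[of "q (c + h) - q c" "q c - q 0"]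
        by (simp add: distrib_left)
      then have "c + h \<in> A"
        using h c by (simp add: A_def)
      then have "c + h \<le> c"
        unfolding c_def using bdd by (intro cSup_upper) auto
      then show False using h by simp
    qed
    then show ?thesis using c by simp
  qed
  show ?thesis
  proof (rule field_le_epsilon)
    fix e :: real assume e: "e > 0"
    \<comment> \<open>Dividing by \<open>b + 1\<close> instead of \<open>b\<close> covers
      \<open>b = 0\<close>.\<close>
    have "norm (q b - q 0) \<le> (K + e / (b + 1)) * b"
      using e b by (intro *) auto
    also have "\<dots> = K * b + e * (b / (b + 1))"
      by (simp add: distrib_right)
    also have "\<dots> \<le> K * b + e * 1"
      using e b by (intro add_left_mono mult_left_mono) auto
    finally show "norm (q b - q 0) \<le> K * b + e" by simp
  qed
qed

text \<open>Factoring \<open>U (b - s)\<close> as \<open>U (b - (s + h))\<close> after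
  \<open>U h\<close> shows that only the defect of \<open>w\<close> from the \<open>U\<close>-orbit
  through \<open>w s\<close> has to be differentiated.\<close>

lemma C0_semigroup_propagated_derivative:
  fixes U :: "real \<Rightarrow> 'x::banach op"
  assumes U: "C0_semigroup U" and s: "s < b"
    and w: "((\<lambda>h. (1 / h) *\<^sub>R (w (s + h) - U h (w s))) \<longlongrightarrow> l) (at_right 0)"
  shows "((\<lambda>h. (1 / h) *\<^sub>R (U (b - (s + h)) (w (s + h)) - U (b - s) (w s))) \<longlongrightarrow> U (b - s) l) (at_right 0)"
proof -
  have small: "\<forall>\<^sub>F h in at_right 0. h \<in> {0<..<b - s}"
    using s by (intro eventually_at_right_real) auto
  have "((\<lambda>h. U (b - (s + h)) ((1 / h) *\<^sub>R (w (s + h) - U h (w s)))) \<longlongrightarrow> U (b - s) l) (at_right 0)"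
  proof (rule tendsto_C0_semigroup[OF U _ _ _ w])
    have "((\<lambda>h. b - (s + h)) \<longlongrightarrow> b - (s + 0)) (at_right 0)"
      by (intro tendsto_intros)
    then show "((\<lambda>h. b - (s + h)) \<longlongrightarrow> b - s) (at_right 0)" by simp
    show "\<forall>\<^sub>F h in at_right 0. 0 \<le> b - (s + h)"
      using small by eventually_elim auto
  qed (use s in simp)
  moreover have "\<forall>\<^sub>F h in at_right 0. U (b - (s + h)) ((1 / h) *\<^sub>R (w (s + h) - U h (w s)))
      = (1 / h) *\<^sub>R (U (b - (s + h)) (w (s + h)) - U (b - s) (w s))"
    using small
  proof eventually_elim
    case (elim h)
    then interpret bounded_linear "U (b - (s + h))"
      using U by (intro C0_semigroup_bounded_linear) auto
    show ?case
      using C0_semigroup_add[OF U, of "b - (s + h)" h "w s"] elim by (simp add: scale diff)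
  qed
  ultimately show ?thesis
    by (rule Lim_transform_eventually)
qed

section \<open>Perturbation by a relatively bounded operator\<close>

locale smoothing_semigroup = embedded_banach Y nY
  for Y :: "'x::banach set" and nY +
  fixes S :: "real \<Rightarrow> 'x op" and \<eta> :: "real \<Rightarrow> real"
  assumes S: "C0_semigroup S"
    and S_Y: "\<forall>t\<ge>0. S t ` Y \<subseteq> Y"
    and S_Ycont: "\<forall>y\<in>Y. Ycontinuous_on nY {0..} (\<lambda>t. S t y)"
    and eta_pos: "\<forall>d>0. 0 < \<eta> d"
    and eta_est: "\<forall>s0 s1 \<phi>. 0 \<le> s0 \<longrightarrow> s0 < s1 \<longrightarrow> continuous_on {s0..s1} \<phi> \<longrightarrow>
         integral {s0..s1} (\<lambda>s. S (s1 - s) (\<phi> s)) \<in> Y \<and>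
         nY (integral {s0..s1} (\<lambda>s. S (s1 - s) (\<phi> s)))
           \<le> \<eta> (s1 - s0) * (SUP s\<in>{s0..s1}. norm (\<phi> s))"
begin

lemma S_in_Y: "0 \<le> t \<Longrightarrow> y \<in> Y \<Longrightarrow> S t y \<in> Y"
  using S_Y by blast

lemma eta_bound:
  assumes "0 \<le> s0" "s0 < s1" "continuous_on {s0..s1} \<phi>" "\<And>s. s \<in> {s0..s1} \<Longrightarrow> norm (\<phi> s) \<le> B"
  shows "integral {s0..s1} (\<lambda>s. S (s1 - s) (\<phi> s)) \<in> Y"
    and "nY (integral {s0..s1} (\<lambda>s. S (s1 - s) (\<phi> s))) \<le> \<eta> (s1 - s0) * B"
proof -
  have "(SUP s\<in>{s0..s1}. norm (\<phi> s)) \<le> B"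
    using assms by (intro cSUP_least) auto
  then have "\<eta> (s1 - s0) * (SUP s\<in>{s0..s1}. norm (\<phi> s)) \<le> \<eta> (s1 - s0) * B"
    using eta_pos assms(2) by (intro mult_left_mono) (auto intro: less_imp_le)
  then show "integral {s0..s1} (\<lambda>s. S (s1 - s) (\<phi> s)) \<in> Y"
    and "nY (integral {s0..s1} (\<lambda>s. S (s1 - s) (\<phi> s))) \<le> \<eta> (s1 - s0) * B"
    using eta_est assms order_trans by blast+
qed

text \<open>The identity \<open>t S(t) x = \<integral>\<^sub>0\<^sup>t S(t - s) S(s) x ds\<close> makes the smoothing estimate applicable
  to the single operators \<open>S(t)\<close>.\<close>

lemma S_smoothing:
  assumes t: "0 < t"
  shows "S t x \<in> Y" and "\<exists>C. \<forall>x. nY (S t x) \<le> C * norm x"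
proof -
  obtain M where M: "M > 0" "\<And>s x. 0 \<le> s \<Longrightarrow> s \<le> t \<Longrightarrow> norm (S s x) \<le> M * norm x"
    using C0_semigroup_locally_bounded[OF S] by blast
  have eq: "S t x = (1 / t) *\<^sub>R integral {0..t} (\<lambda>s. S (t - s) (S s x))" for x
  proof -
    have "integral {0..t} (\<lambda>s. S (t - s) (S s x)) = integral {0..t} (\<lambda>s. S t x)"
      using C0_semigroup_add[OF S] by (intro integral_cong) (metis atLeastAtMost_iff diff_add_cancel diff_ge_0_iff_ge)
    then show ?thesis using t by simp
  qed
  have *: "integral {0..t} (\<lambda>s. S (t - s) (S s x)) \<in> Y"
    "nY (integral {0..t} (\<lambda>s. S (t - s) (S s x))) \<le> \<eta> (t - 0) * (M * norm x)" for x
    using t M(2) continuous_on_subset[OF C0_semigroup_continuous[OF S, of x], of "{0..t}"]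
    by (intro eta_bound; auto)+
  show "S t x \<in> Y"
    using eq[of x] Y_scale[OF *(1)] by simp
  have "nY (S t x) \<le> (\<eta> t * M / t) * norm x" for x
    using *(2)[of x] t by (subst eq, subst nY_scale[OF *(1)]) (simp add: field_simps)
  then show "\<exists>C. \<forall>x. nY (S t x) \<le> C * norm x" by blast
qed

text \<open>Uniform boundedness, now on \<open>Y\<close>: each \<open>S t\<close> is bounded there,
  trivially for \<open>t = 0\<close> and by smoothing composed with the embedding for
  \<open>t > 0\<close>, while orbits are bounded by their continuity in \<open>Y\<close>.\<close>

lemma S_Y_locally_bounded:
  "\<exists>N\<ge>0. \<forall>t\<in>{0..b}. \<forall>y\<in>Y. nY (S t y) \<le> N * nY y"
proof (rule uniform_boundedness)
  fix t assume t: "t \<in> {0..b}"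
  then interpret bounded_linear "S t"
    using S by (intro C0_semigroup_bounded_linear) auto
  show "nY (S t (x + y)) \<le> nY (S t x) + nY (S t y)" if "x \<in> Y" "y \<in> Y" for x y
    using t that by (simp add: add nY_triangle S_in_Y)
  show "nY (S t (a *\<^sub>R x)) = \<bar>a\<bar> * nY (S t x)" if "x \<in> Y" for a x
    using t that by (simp add: scale nY_scale S_in_Y)
  show "\<exists>C. \<forall>x\<in>Y. nY (S t x) \<le> C * nY x"
  proof (cases "t = 0")
    case True
    then show ?thesis by (intro exI[of _ 1]) (simp add: C0_semigroup_zero[OF S])
  next
    case False
    then obtain C where C: "\<forall>x. nY (S t x) \<le> C * norm x"
      using S_smoothing(2)[of t] t by auto
    have "nY (S t x) \<le> (\<bar>C\<bar> * embed_const) * nY x" if x: "x \<in> Y" for x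
    proof -
      have "nY (S t x) \<le> C * norm x" using C by blast
      also have "\<dots> \<le> \<bar>C\<bar> * norm x" by (intro mult_right_mono) auto
      also have "\<dots> \<le> \<bar>C\<bar> * (embed_const * nY x)"
        using embed_const(2)[OF x] by (intro mult_left_mono) auto
      finally show ?thesis by simp
    qed
    then show ?thesis by blast
  qed
next
  fix x assume x: "x \<in> Y"
  have "Ycontinuous_on nY {0..b} (\<lambda>t. S t x)"
    using S_Ycont x by (auto intro: Ycontinuous_on_subset)
  then obtain B where "\<And>t. t \<in> {0..b} \<Longrightarrow> nY (S t x) \<le> B"
    by (rule Ycontinuous_bounded) (use S_in_Y[OF _ x] in auto)
  then show "\<exists>B. \<forall>t\<in>{0..b}. nY (S t x) \<le> B" by blast
qed

end

section \<open>Variation of constants for the perturbed semigroup\<close>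

locale perturbed_semigroup = smoothing_semigroup Y nY S \<eta>
  for Y :: "'x::banach set" and nY S \<eta> +
  fixes D :: "'x set" and G H :: "'x op" and K \<gamma> :: real and U :: "real \<Rightarrow> 'x op"
  assumes gen_S: "generates D G S"
    and gen_U: "generates D (\<lambda>x. G x - \<gamma> *\<^sub>R H x) U"
    and D_Y: "D \<subseteq> Y"
    and D_dense: "\<forall>y\<in>Y. \<forall>e>0. \<exists>x\<in>D. nY (x - y) < e"
    and H_lin: "\<forall>y\<in>Y. \<forall>z\<in>Y. \<forall>a b. H (a *\<^sub>R y + b *\<^sub>R z) = a *\<^sub>R H y + b *\<^sub>R H z"
    and K_pos: "K > 0" and H_bound: "\<forall>y\<in>Y. norm (H y) \<le> K * nY y"
    and gamma_nonneg: "0 \<le> \<gamma>"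
begin

lemma U: "C0_semigroup U"
  using gen_U by (simp add: generates_def)

lemma H_diff: "y \<in> Y \<Longrightarrow> z \<in> Y \<Longrightarrow> H (y - z) = H y - H z"
  using H_lin[rule_format, of y z 1 "- 1"] by simp

lemma continuous_on_H:
  assumes "Ycontinuous_on nY A v" "\<And>t. t \<in> A \<Longrightarrow> v t \<in> Y"
  shows "continuous_on A (\<lambda>t. H (v t))"
proof (rule continuous_on_dominated_by_nY[OF assms(1)])
  fix s t assume "s \<in> A" "t \<in> A"
  then have "v s \<in> Y" "v t \<in> Y" by (simp_all add: assms(2))
  then show "dist (H (v s)) (H (v t)) \<le> K * nY (v s - v t)"
    using H_bound Y_diff by (metis dist_norm H_diff)
qed (fact assms(2))

lemma difference_quotient_on_domain:
  assumes "x \<in> D"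
  shows "((\<lambda>h. (1 / h) *\<^sub>R (S h x - U h x)) \<longlongrightarrow> \<gamma> *\<^sub>R H x) (at_right 0)"
proof -
  have "((\<lambda>h. (1 / h) *\<^sub>R (S h x - x) - (1 / h) *\<^sub>R (U h x - x)) \<longlongrightarrow> G x - (G x - \<gamma> *\<^sub>R H x)) (at_right 0)"
    using gen_S gen_U assms unfolding generates_def by (intro tendsto_diff) auto
  then show ?thesis
    by (simp add: scaleR_diff_right algebra_simps)
qed

text \<open>For \<open>x\<close> in \<open>D\<close> the path
  \<open>s \<mapsto> U (h - s) (S s x)\<close> joins \<open>U h x\<close> to \<open>S h x\<close>
  with right derivative \<open>U (h - s) (\<gamma> *\<^sub>R H (S s x))\<close>, bounded by a
  multiple of \<open>nY x\<close>. Density of \<open>D\<close> in \<open>Y\<close> extends the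
  estimate.\<close>

lemma difference_bound:
  "\<exists>C\<ge>0. \<forall>h\<in>{0..1}. \<forall>x\<in>Y. norm (S h x - U h x) \<le> C * h * nY x"
proof -
  obtain M where M: "M > 0" "\<And>t x. 0 \<le> t \<Longrightarrow> t \<le> 1 \<Longrightarrow> norm (U t x) \<le> M * norm x"
    using C0_semigroup_locally_bounded[OF U] by blast
  obtain M' where M': "M' > 0" "\<And>t x. 0 \<le> t \<Longrightarrow> t \<le> 1 \<Longrightarrow> norm (S t x) \<le> M' * norm x"
    using C0_semigroup_locally_bounded[OF S] by blast
  obtain N where N: "N \<ge> 0" "\<forall>t\<in>{0..1}. \<forall>y\<in>Y. nY (S t y) \<le> N * nY y"
    using S_Y_locally_bounded by blast
  define C where "C = M * (\<gamma> * (K * N))"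
  have C: "C \<ge> 0" using M(1) N(1) K_pos gamma_nonneg by (simp add: C_def)
  have on_D: "norm (S h x - U h x) \<le> C * nY x * h" if h: "0 \<le> h" "h \<le> 1" and x: "x \<in> D" for h x
  proof -
    have xY: "x \<in> Y" using x D_Y by blast
    let ?q = "\<lambda>s. U (h - s) (S s x)"
    have "norm (?q h - ?q 0) \<le> (C * nY x) * h"
    proof (rule right_derivative_bound[OF h(1)])
      show "continuous_on {0..h} ?q"
        using continuous_on_subset[OF C0_semigroup_continuous[OF S]]
        by (intro continuous_on_C0_convolution[OF U]) auto
    next
      fix s assume s: "0 \<le> s" "s < h"
      have Sx: "S s x \<in> D" using generates_invariant[OF gen_S x s(1)] .
      have "((\<lambda>k. (1 / k) *\<^sub>R (S (s + k) x - U k (S s x))) \<longlongrightarrow> \<gamma> *\<^sub>R H (S s x)) (at_right 0)"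
      proof -
        have "\<forall>\<^sub>F k in at_right 0. (1 / k) *\<^sub>R (S k (S s x) - U k (S s x))
            = (1 / k) *\<^sub>R (S (s + k) x - U k (S s x))"
          using eventually_at_right_real[OF zero_less_one]
          by (eventually_elim) (use s C0_semigroup_add[OF S] in \<open>auto simp: add.commute\<close>)
        with difference_quotient_on_domain[OF Sx] show ?thesis
          by (rule Lim_transform_eventually)
      qed
      from C0_semigroup_propagated_derivative[OF U s(2) this]
      show "((\<lambda>k. (1 / k) *\<^sub>R (?q (s + k) - ?q s)) \<longlongrightarrow> U (h - s) (\<gamma> *\<^sub>R H (S s x))) (at_right 0)" .
      have "norm (U (h - s) (\<gamma> *\<^sub>R H (S s x))) \<le> M * norm (\<gamma> *\<^sub>R H (S s x))"
        using s h by (intro M(2)) auto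
      also have "\<dots> \<le> M * (\<gamma> * (K * (N * nY x)))"
      proof -
        have "norm (H (S s x)) \<le> K * nY (S s x)" using H_bound D_Y Sx by blast
        also have "\<dots> \<le> K * (N * nY x)"
          using N(2) K_pos xY s h by (intro mult_left_mono) auto
        finally show ?thesis
          using M(1) gamma_nonneg by (simp add: mult_left_mono)
      qed
      finally show "norm (U (h - s) (\<gamma> *\<^sub>R H (S s x))) \<le> C * nY x"
        by (simp add: C_def mult.assoc)
    qed
    then show ?thesis
      by (simp add: C0_semigroup_zero[OF U] C0_semigroup_zero[OF S])
  qed
  have "norm (S h x - U h x) \<le> C * h * nY x" if h: "0 \<le> h" "h \<le> 1" and x: "x \<in> Y" for h x
  proof (rule field_le_epsilon)
    fix e :: real assume e: "e > 0"
    \<comment> \<open>\<open>R\<close> collects the coefficients of \<open>nY (z - x)\<close>: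
      \<open>C * h\<close> from replacing \<open>nY z\<close> by \<open>nY x\<close>, the second
      term from applying both semigroups to \<open>x - z\<close>; the 1 makes it positive.\<close>
    define R where "R = C * h + (M' + M) * embed_const + 1"
    have R: "R > 0"
      using C h M(1) M'(1) embed_const(1) by (simp add: R_def add_nonneg_pos)
    obtain z where z: "z \<in> D" "nY (z - x) < e / R"
      using D_dense x e R by (meson divide_pos_pos)
    have zY: "z \<in> Y" using z D_Y by blast
    have lin: "S h (x - z) = S h x - S h z" "U h (x - z) = U h x - U h z"
      using h C0_semigroup_bounded_linear[OF S] C0_semigroup_bounded_linear[OF U]
      by (simp_all add: bounded_linear.linear linear_diff)
    have xz: "norm (x - z) \<le> embed_const * nY (z - x)"
      using embed_const(2)[OF Y_diff[OF x zY]] nY_commute[OF x zY] by simp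
    have "norm (S h x - U h x) = norm ((S h z - U h z) + (S h (x - z) - U h (x - z)))"
      by (simp add: lin)
    also have "\<dots> \<le> norm (S h z - U h z) + (norm (S h (x - z)) + norm (U h (x - z)))"
      by (rule order_trans[OF norm_triangle_ineq]) (simp add: norm_triangle_ineq4)
    also have "\<dots> \<le> C * nY z * h + (M' * norm (x - z) + M * norm (x - z))"
      using h z by (intro add_mono on_D M M') auto
    also have "\<dots> = C * nY z * h + (M' + M) * norm (x - z)"
      by (simp add: distrib_right)
    also have "\<dots> \<le> C * (nY x + nY (z - x)) * h + (M' + M) * (embed_const * nY (z - x))"
      using nY_diff_ge[OF zY x] xz C h M(1) M'(1)
      by (intro add_mono mult_right_mono mult_left_mono) auto
    also have "\<dots> \<le> C * h * nY x + R * nY (z - x)"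
      using nY_nonneg[OF Y_diff[OF zY x]] by (simp add: R_def algebra_simps)
    also have "\<dots> \<le> C * h * nY x + R * (e / R)"
      using z(2) R by (intro add_left_mono mult_left_mono) auto
    finally show "norm (S h x - U h x) \<le> C * h * nY x + e"
      using R by simp
  qed
  then show ?thesis using C by (intro exI[of _ C]) auto
qed

text \<open>By \<open>difference_bound\<close> the quotients are uniformly bounded from
  \<open>Y\<close> to \<open>X\<close>, so their convergence passes from the dense set
  \<open>D\<close> to all of \<open>Y\<close>.\<close>

lemma difference_quotient:
  assumes x: "x \<in> Y"
  shows "((\<lambda>h. (1 / h) *\<^sub>R (S h x - U h x)) \<longlongrightarrow> \<gamma> *\<^sub>R H x) (at_right 0)"
proof (rule tendstoI)
  fix e :: real assume e: "e > 0"
  obtain C where C: "C \<ge> 0" "\<forall>h\<in>{0..1}. \<forall>x\<in>Y. norm (S h x - U h x) \<le> C * h * nY x"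
    using difference_bound by blast
  define R where "R = C + \<gamma> * K + 1"
  have R: "R > 0" using C K_pos gamma_nonneg by (simp add: R_def add_nonneg_pos)
  obtain z where z: "z \<in> D" "nY (z - x) < e / 2 / R"
    using D_dense x e R by (meson divide_pos_pos half_gt_zero)
  have zY: "z \<in> Y" using z D_Y by blast
  have small: "R * nY (x - z) < e / 2"
    using z(2) R nY_commute[OF x zY] by (simp add: field_simps)
  have "\<forall>\<^sub>F h in at_right 0. dist ((1 / h) *\<^sub>R (S h z - U h z)) (\<gamma> *\<^sub>R H z) < e / 2"
    using e by (intro tendstoD[OF difference_quotient_on_domain[OF z(1)]]) auto
  moreover have "\<forall>\<^sub>F h in at_right 0. h \<in> {0<..<1::real}"
    by (intro eventually_at_right_real) auto
  ultimately show "\<forall>\<^sub>F h in at_right 0. dist ((1 / h) *\<^sub>R (S h x - U h x)) (\<gamma> *\<^sub>R H x) < e"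
  proof eventually_elim
    case (elim h)
    have lin: "S h (x - z) = S h x - S h z" "U h (x - z) = U h x - U h z"
      using elim C0_semigroup_bounded_linear[OF S] C0_semigroup_bounded_linear[OF U]
      by (simp_all add: bounded_linear.linear linear_diff)
    let ?a = "(1 / h) *\<^sub>R (S h (x - z) - U h (x - z))"
      and ?b = "(1 / h) *\<^sub>R (S h z - U h z) - \<gamma> *\<^sub>R H z" and ?c = "\<gamma> *\<^sub>R H (x - z)"
    have a: "norm ?a \<le> C * nY (x - z)"
    proof -
      have "norm (S h (x - z) - U h (x - z)) \<le> C * h * nY (x - z)"
        using C(2) elim Y_diff[OF x zY] by auto
      then show ?thesis using elim by (simp only: norm_scaleR) (simp add: field_simps)
    qed
    have c: "norm ?c \<le> \<gamma> * K * nY (x - z)"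
      using H_bound Y_diff[OF x zY] gamma_nonneg by (simp add: mult_left_mono mult.assoc)
    have "(1 / h) *\<^sub>R (S h x - U h x) - \<gamma> *\<^sub>R H x = ?a + ?b - ?c"
      by (simp add: lin H_diff[OF x zY] algebra_simps)
    then have "norm ((1 / h) *\<^sub>R (S h x - U h x) - \<gamma> *\<^sub>R H x) \<le> norm ?a + norm ?b + norm ?c"
      using norm_triangle_ineq4[of "?a + ?b" ?c] norm_triangle_ineq[of ?a ?b] by simp
    also have "\<dots> \<le> C * nY (x - z) + norm ?b + \<gamma> * K * nY (x - z)"
      using a c by simp
    also have "\<dots> \<le> R * nY (x - z) + norm ?b"
      using nY_nonneg[OF Y_diff[OF x zY]] by (simp add: R_def algebra_simps)
    also have "\<dots> < e"
      using small elim by (simp add: dist_norm)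
    finally show ?case by (simp add: dist_norm)
  qed
qed

text \<open>The function \<open>?q\<close> has right derivative 0, hence \<open>?q b = ?q 0\<close>,
  which is the asserted formula.\<close>

lemma variation_of_constants:
  assumes b: "0 \<le> b" and v_Y: "\<And>t. t \<in> {0..b} \<Longrightarrow> v t \<in> Y"
    and v: "Ycontinuous_on nY {0..b} v" and f: "continuous_on {0..b} f"
    and mild: "\<And>t. t \<in> {0..b} \<Longrightarrow> v t = S t (v 0) + integral {0..t} (\<lambda>s. S (t - s) (f s))"
  shows "v b = U b (v 0) + integral {0..b} (\<lambda>s. U (b - s) (f s + \<gamma> *\<^sub>R H (v s)))"
proof -
  let ?p = "\<lambda>s. U (b - s) (v s)" and ?g = "\<lambda>s. U (b - s) (f s + \<gamma> *\<^sub>R H (v s))"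
  let ?q = "\<lambda>s. ?p s - integral {0..s} ?g"
  have g: "continuous_on {0..b} ?g"
    by (intro continuous_on_C0_convolution[OF U] continuous_on_add f
        continuous_on_scaleR continuous_on_const continuous_on_H[OF v v_Y])
  \<comment> \<open>Restarting the mild formula at time \<open>s\<close> isolates the increment over
    \<open>{s..s + h}\<close>, as \<open>v s\<close> need not lie in \<open>D\<close>.\<close>
  have step: "v (s + h) = S h (v s) + integral {s..s + h} (\<lambda>r. S (s + h - r) (f r))"
    if "0 \<le> s" "0 < h" "s + h \<le> b" for s h
  proof -
    let ?k = "\<lambda>r. S (s + h - r) (f r)" and ?l = "\<lambda>r. S (s - r) (f r)"
    have k: "continuous_on {0..s + h} ?k"
      using that by (intro continuous_on_C0_convolution[OF S] continuous_on_subset[OF f]) auto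
    have l: "continuous_on {0..s} ?l"
      using that by (intro continuous_on_C0_convolution[OF S] continuous_on_subset[OF f]) auto
    have "v (s + h) = S (h + s) (v 0) + integral {0..s + h} ?k"
      using mild[of "s + h"] that by (simp add: add.commute)
    also have "integral {0..s + h} ?k = integral {0..s} ?k + integral {s..s + h} ?k"
      using that k by (intro Henstock_Kurzweil_Integration.integral_combine[symmetric]
          integrable_continuous_real) auto
    also have "integral {0..s} ?k = integral {0..s} (S h \<circ> ?l)"
    proof (rule integral_cong)
      fix r assume "r \<in> {0..s}"
      then show "?k r = (S h \<circ> ?l) r"
        using C0_semigroup_add[OF S, of h "s - r" "f r"] that by (simp add: algebra_simps)
    qed
    also have "\<dots> = S h (integral {0..s} ?l)"
      using that l by (intro integral_linear integrable_continuous_real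
          C0_semigroup_bounded_linear[OF S]) auto
    also have "S (h + s) (v 0) = S h (S s (v 0))"
      using that by (intro C0_semigroup_add[OF S]) auto
    finally have "v (s + h) = S h (S s (v 0)) + S h (integral {0..s} ?l) + integral {s..s + h} ?k"
      by (simp add: add.assoc)
    also have "S h (S s (v 0)) + S h (integral {0..s} ?l) = S h (v s)"
      using mild[of s] that bounded_linear.linear[OF C0_semigroup_bounded_linear[OF S, of h]]
      by (simp add: linear_add)
    finally show ?thesis .
  qed
  have "norm (?q b - ?q 0) \<le> 0 * b"
  proof (rule right_derivative_bound[OF b])
    show "continuous_on {0..b} ?q"
      by (intro continuous_on_diff continuous_on_C0_convolution[OF U]
          Ycontinuous_imp_continuous_on[OF v v_Y] indefinite_integral_continuous_1
          integrable_continuous_real g)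
  next
    fix s assume s: "0 \<le> s" "s < b"
    have small: "\<forall>\<^sub>F h in at_right 0. h \<in> {0<..<b - s}"
      using s by (intro eventually_at_right_real) auto
    \<comment> \<open>The defect \<open>v (s + h) - U h (v s)\<close> splits into the difference of
      the two semigroups at \<open>v s\<close> and an average of \<open>f\<close>.\<close>
    have "((\<lambda>h. (1 / h) *\<^sub>R (S h (v s) - U h (v s))
        + (1 / h) *\<^sub>R integral {s..s + h} (\<lambda>r. S (s + h - r) (f r))) \<longlongrightarrow> \<gamma> *\<^sub>R H (v s) + f s) (at_right 0)"
      using s v_Y by (intro tendsto_add difference_quotient C0_semigroup_average_tendsto[OF S f]) auto
    moreover have "\<forall>\<^sub>F h in at_right 0. (1 / h) *\<^sub>R (S h (v s) - U h (v s))
        + (1 / h) *\<^sub>R integral {s..s + h} (\<lambda>r. S (s + h - r) (f r))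
        = (1 / h) *\<^sub>R (v (s + h) - U h (v s))"
      using small
    proof eventually_elim
      case (elim h)
      then have "v (s + h) = S h (v s) + integral {s..s + h} (\<lambda>r. S (s + h - r) (f r))"
        using s by (intro step) auto
      then show ?case
        by (simp only:) (simp add: algebra_simps)
    qed
    ultimately have "((\<lambda>h. (1 / h) *\<^sub>R (v (s + h) - U h (v s))) \<longlongrightarrow> f s + \<gamma> *\<^sub>R H (v s)) (at_right 0)"
      unfolding add.commute[of "f s"] by (rule Lim_transform_eventually)
    from C0_semigroup_propagated_derivative[OF U s(2) this]
    have "((\<lambda>h. (1 / h) *\<^sub>R (?p (s + h) - ?p s)) \<longlongrightarrow> ?g s) (at_right 0)" .
    from tendsto_diff[OF this integral_right_derivative[OF g s]]
    show "((\<lambda>h. (1 / h) *\<^sub>R (?q (s + h) - ?q s)) \<longlongrightarrow> 0) (at_right 0)"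
      by (simp add: algebra_simps)
  qed simp
  then have "?q b = ?q 0" by simp
  then show ?thesis
    by (simp add: C0_semigroup_zero[OF U] algebra_simps)
qed

end

section \<open>Comparison of the two semigroups\<close>

context perturbed_semigroup
begin

lemma Duhamel_on_Y:
  assumes t: "0 \<le> t" and y: "y \<in> Y"
  shows "S t y = U t y + integral {0..t} (\<lambda>s. U (t - s) (\<gamma> *\<^sub>R H (S s y)))"
proof -
  have "S t y = U t (S 0 y) + integral {0..t} (\<lambda>s. U (t - s) (0 + \<gamma> *\<^sub>R H (S s y)))"
  proof (rule variation_of_constants[where v = "\<lambda>s. S s y" and f = "\<lambda>_. 0", OF t])
    show "Ycontinuous_on nY {0..t} (\<lambda>s. S s y)"
      using S_Ycont y by (auto intro: Ycontinuous_on_subset)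
  next
    fix s assume "s \<in> {0..t}"
    have "integral {0..s} (\<lambda>r. S (s - r) 0) = integral {0..s} (\<lambda>r. 0)"
      by (intro integral_cong linear_0 bounded_linear.linear C0_semigroup_bounded_linear[OF S]) auto
    then show "S s y = S s (S 0 y) + integral {0..s} (\<lambda>r. S (s - r) 0)"
      by (simp add: C0_semigroup_zero[OF S])
  qed (use y S_in_Y in auto)
  then show ?thesis
    by (simp add: C0_semigroup_zero[OF S])
qed

text \<open>\<open>S \<epsilon> x\<close> belongs to \<open>Y\<close> for
  \<open>\<epsilon> > 0\<close> and tends to \<open>x\<close>, so relations between the semigroups
  established on \<open>Y\<close> extend to \<open>X\<close>.\<close>

lemma S_mollified_tendsto:
  assumes V: "C0_semigroup V" and t: "0 \<le> t"
  shows "((\<lambda>\<epsilon>. V t (S \<epsilon> x)) \<longlongrightarrow> V t x) (at_right 0)"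
proof -
  have pos: "\<forall>\<^sub>F \<epsilon> in at_right (0::real). 0 \<le> \<epsilon>"
    using eventually_at_right_less by (rule eventually_mono) simp
  have "((\<lambda>\<epsilon>. S \<epsilon> x) \<longlongrightarrow> S 0 x) (at_right 0)"
    using pos by (intro tendsto_C0_semigroup[OF S] tendsto_intros) auto
  then show ?thesis
    using C0_semigroup_zero[OF S] t by (intro tendsto_C0_semigroup[OF V] tendsto_const) auto
qed

text \<open>For \<open>\<gamma> = 0\<close> the Duhamel integral vanishes. This serves to carry
  positivity to \<open>S\<close> from the semigroup that (e) provides for
  \<open>G - 0 H\<close>.\<close>

lemma semigroups_agree:
  assumes "\<gamma> = 0" and t: "0 \<le> t"
  shows "S t x = U t x"
proof -
  have "S t y = U t y" if "y \<in> Y" for y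
  proof -
    have "integral {0..t} (\<lambda>s. U (t - s) (\<gamma> *\<^sub>R H (S s y))) = integral {0..t} (\<lambda>s. 0)"
      using \<open>\<gamma> = 0\<close>
      by (intro integral_cong) (auto intro!: linear_0 bounded_linear.linear C0_semigroup_bounded_linear[OF U])
    then show ?thesis using Duhamel_on_Y[OF t that] by simp
  qed
  then have "\<forall>\<^sub>F \<epsilon> in at_right 0. S t (S \<epsilon> x) = U t (S \<epsilon> x)"
    using eventually_at_right_less by (rule eventually_mono[rotated]) (auto simp: S_smoothing(1))
  from Lim_transform_eventually[OF S_mollified_tendsto[OF S t] this]
  show ?thesis
    using S_mollified_tendsto[OF U t] by (intro tendsto_unique[of "at_right 0"]) auto
qed

end

text \<open>The Duhamel integrand is nonnegative on positive elements of \<open>Y\<close>;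
  mollification by \<open>S \<epsilon>\<close> preserves positivity and reaches all positive
  \<open>x\<close>.\<close>

lemma perturbed_semigroup_dominated:
  fixes Y :: "'x::{banach,ordered_real_vector,lattice} set"
  assumes pert: "perturbed_semigroup Y nY S \<eta> D G H K \<gamma> U"
    and X_lat: "banach_lattice_X TYPE('x)"
    and S_pos: "positive_semigroup S" and U_pos: "positive_semigroup U"
    and H_pos: "\<forall>y\<in>Y. 0 \<le> y \<longrightarrow> 0 \<le> H y"
    and t: "0 \<le> t" and x: "0 \<le> x"
  shows "U t x \<le> S t x"
proof -
  interpret perturbed_semigroup Y nY S \<eta> D G H K \<gamma> U by (rule pert)
  have on_Y: "0 \<le> S t y - U t y" if y: "y \<in> Y" "0 \<le> y" for y
  proof -
    have "continuous_on {0..t} (\<lambda>s. H (S s y))"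
      using S_Ycont y S_in_Y by (intro continuous_on_H) (auto intro: Ycontinuous_on_subset)
    then have "continuous_on {0..t} (\<lambda>s. U (t - s) (\<gamma> *\<^sub>R H (S s y)))"
      by (intro continuous_on_C0_convolution[OF U] continuous_on_scaleR continuous_on_const)
    then have "0 \<le> integral {0..t} (\<lambda>s. U (t - s) (\<gamma> *\<^sub>R H (S s y)))"
    proof (intro integral_nonneg_banach_lattice[OF X_lat] integrable_continuous_real)
      fix s assume s: "s \<in> {0..t}"
      then have "0 \<le> H (S s y)"
        using S_pos H_pos y S_in_Y by (simp add: positive_semigroup_def)
      then have "0 \<le> \<gamma> *\<^sub>R H (S s y)"
        by (intro scaleR_nonneg_nonneg gamma_nonneg)
      then show "0 \<le> U (t - s) (\<gamma> *\<^sub>R H (S s y))"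
        using U_pos s by (simp add: positive_semigroup_def)
    qed
    then show ?thesis using Duhamel_on_Y[OF t y(1)] by simp
  qed
  have "\<forall>\<^sub>F \<epsilon> in at_right 0. 0 \<le> S t (S \<epsilon> x) - U t (S \<epsilon> x)"
    using eventually_at_right_less
  proof (rule eventually_mono)
    fix \<epsilon> :: real assume "0 < \<epsilon>"
    then show "0 \<le> S t (S \<epsilon> x) - U t (S \<epsilon> x)"
      using S_pos x by (intro on_Y S_smoothing(1)) (auto simp: positive_semigroup_def)
  qed
  then have "0 \<le> S t x - U t x"
    by (rule nonneg_tendsto[OF X_lat tendsto_diff[OF S_mollified_tendsto[OF S t] S_mollified_tendsto[OF U t]],
          rotated]) simp
  then show ?thesis by simp
qed

lemma F_continuous_along_curve:
  assumes F: "F_continuous T Y nY F" and A: "A \<subseteq> Ico0 T"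
    and w: "Ycontinuous_on nY A w" "\<And>s. s \<in> A \<Longrightarrow> w s \<in> Y"
  shows "continuous_on A (\<lambda>s. F s (w s))"
  unfolding continuous_on_iff
proof (intro ballI allI impI)
  fix t e :: real assume t: "t \<in> A" and e: "e > 0"
  then obtain d where d: "d > 0" "\<forall>t'\<in>Ico0 T. \<forall>y'\<in>Y.
      \<bar>t' - t\<bar> < d \<longrightarrow> nY (y' - w t) < d \<longrightarrow> norm (F t' y' - F t (w t)) < e"
    using F A w(2)[OF t] unfolding F_continuous_def by (meson subsetD)
  obtain d' where d': "d' > 0" "\<forall>s\<in>A. \<bar>s - t\<bar> < d' \<longrightarrow> nY (w s - w t) < d"
    using w(1) t d(1) unfolding Ycontinuous_on_def by blast
  show "\<exists>d>0. \<forall>s\<in>A. dist s t < d \<longrightarrow> dist (F s (w s)) (F t (w t)) < e"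
    using d d' A w(2)
    by (intro exI[of _ "min d d'"]) (auto simp: dist_norm subset_iff)
qed

section \<open>Vanishing of the negative part of the mild solution\<close>

theorem theorem3p4:
  fixes Y :: "'x::{banach,ordered_real_vector,lattice} set"
    and nY :: "'x \<Rightarrow> real"
    and T :: ereal
    and D :: "'x set" and G :: "'x \<Rightarrow> 'x"
    and S :: "real \<Rightarrow> 'x \<Rightarrow> 'x"
    and \<eta> :: "real \<Rightarrow> real"
    and F :: "real \<Rightarrow> 'x \<Rightarrow> 'x"
    and H :: "'x \<Rightarrow> 'x"
    and u0 :: 'x and tmax :: ereal and u :: "real \<Rightarrow> 'x"
  assumes XY: "banach_embedded Y nY"
    and T_pos: "0 < T"
    \<comment> \<open>(a)\<close>
    and gen: "generates D G S"
    and S_Y: "\<forall>t\<ge>0. S t ` Y \<subseteq> Y"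
    and S_Ycont: "\<forall>y\<in>Y. Ycontinuous_on nY {0..} (\<lambda>t. S t y)"
    \<comment> \<open>(b)\<close>
    and eta_pos: "\<forall>d>0. 0 < \<eta> d"
    and eta_lim: "(\<eta> \<longlongrightarrow> 0) (at_right 0)"
    and eta_est: "\<forall>s0 s1 \<phi>. 0 \<le> s0 \<longrightarrow> s0 < s1 \<longrightarrow> continuous_on {s0..s1} \<phi> \<longrightarrow>
         integral {s0..s1} (\<lambda>s. S (s1 - s) (\<phi> s)) \<in> Y \<and>
         nY (integral {s0..s1} (\<lambda>s. S (s1 - s) (\<phi> s)))
           \<le> \<eta> (s1 - s0) * (SUP s\<in>{s0..s1}. norm (\<phi> s))"
    \<comment> \<open>(c)\<close>
    and F_cont: "F_continuous T Y nY F"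
    and F_Lip: "F_loc_Lipschitz T Y nY F"
    \<comment> \<open>(d)\<close>
    and X_lat: "banach_lattice_X TYPE('x)"
    and Y_lat: "banach_sublattice Y nY"
    and D_sub: "subspace D" and D_Y: "D \<subseteq> Y"
    and D_dense: "\<forall>y\<in>Y. \<forall>e>0. \<exists>x\<in>D. nY (x - y) < e"
    \<comment> \<open>(e)\<close>
    and H_lin: "\<forall>y\<in>Y. \<forall>z\<in>Y. \<forall>a b. H (a *\<^sub>R y + b *\<^sub>R z) = a *\<^sub>R H y + b *\<^sub>R H z"
    and H_pos: "\<forall>y\<in>Y. 0 \<le> y \<longrightarrow> 0 \<le> H y"
    and H_gen: "\<forall>\<gamma>\<ge>0. \<exists>S\<gamma>. generates D (\<lambda>x. G x - \<gamma> *\<^sub>R H x) S\<gamma> \<and>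
         positive_semigroup S\<gamma> \<and> (\<forall>t\<ge>0. S\<gamma> t ` Y \<subseteq> Y)"
    \<comment> \<open>(f)\<close>
    and F_H: "\<forall>\<tau>\<in>Ico0 T. \<forall>r>0. \<exists>\<gamma>\<ge>0. \<forall>v\<in>Y. \<forall>t\<in>{0..\<tau>}.
         0 \<le> v \<longrightarrow> nY v \<le> r \<longrightarrow> 0 \<le> F t v + \<gamma> *\<^sub>R H v"
    \<comment> \<open>initial value and maximal mild solution\<close>
    and u0_Y: "u0 \<in> Y" and u0_pos: "0 \<le> u0"
    and tmax: "0 < tmax" "tmax \<le> T"
    and u_max: "maximal_mild_solution T Y nY S F u0 tmax u"
  shows "\<forall>t\<in>Ico0 tmax. 0 \<le> u t"
proof
  fix \<tau> assume \<tau>_in: "\<tau> \<in> Ico0 tmax"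
  then have \<tau>: "0 \<le> \<tau>" "\<tau> \<in> Ico0 T"
    using tmax(2) by (auto simp: Ico0_def)
  have sub: "{0..\<tau>} \<subseteq> Ico0 tmax" "{0..\<tau>} \<subseteq> Ico0 T"
    using \<tau>_in tmax(2) by (auto simp: Ico0_def order_le_less_trans[OF ereal_less_eq(3)[THEN iffD2]])
  have S: "C0_semigroup S"
    using gen by (simp add: generates_def)
  interpret smoothing_semigroup Y nY S \<eta>
    using XY S S_Y S_Ycont eta_pos eta_est by unfold_locales
  obtain K where K: "K > 0" "\<forall>y\<in>Y. norm (H y) \<le> K * nY y"
    using positive_operator_bounded[OF XY X_lat Y_lat H_lin H_pos] by blast
  have perturbed: "perturbed_semigroup Y nY S \<eta> D G H K \<gamma> U"
    if "0 \<le> \<gamma>" "generates D (\<lambda>x. G x - \<gamma> *\<^sub>R H x) U" for \<gamma> U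
    using gen that D_Y D_dense H_lin K by unfold_locales
  obtain S0 where S0: "generates D (\<lambda>x. G x - 0 *\<^sub>R H x) S0" "positive_semigroup S0"
    using H_gen by blast
  have S_pos: "positive_semigroup S"
    using S0(2) perturbed_semigroup.semigroups_agree[OF perturbed[OF order_refl S0(1)]]
    by (simp add: positive_semigroup_def)

  have u_Y: "u t \<in> Y" if "t \<in> {0..\<tau>}" for t
    using u_max that sub(1) by (auto simp: maximal_mild_solution_def mild_solution_def)
  have u_cont: "Ycontinuous_on nY {0..\<tau>} u"
    using u_max sub(1) by (auto simp: maximal_mild_solution_def mild_solution_def
        intro: Ycontinuous_on_subset)
  have u_mild: "u t = S t u0 + integral {0..t} (\<lambda>s. S (t - s) (F s (u s)))" if "t \<in> {0..\<tau>}" for t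
    using u_max that sub(1) by (auto simp: maximal_mild_solution_def mild_solution_def)
  have u_0: "u 0 = u0"
    using u_mild[of 0] \<tau>(1) by (simp add: C0_semigroup_zero[OF S])
  \<comment> \<open>The ball of radius \<open>r\<close> will also contain the positive parts
    (\<open>p_r\<close>). The same \<open>r\<close> therefore fixes \<open>\<gamma>\<close>, applied
    to the positive parts, and the constant \<open>L\<close>, comparing them with
    \<open>u\<close>.\<close>
  obtain r where r: "r > 0" "\<And>t. t \<in> {0..\<tau>} \<Longrightarrow> nY (u t) \<le> r"
    using Ycontinuous_bounded[OF u_cont u_Y] by metis
  obtain \<gamma> where \<gamma>: "\<gamma> \<ge> 0" "\<And>v t. v \<in> Y \<Longrightarrow> t \<in> {0..\<tau>} \<Longrightarrow> 0 \<le> v \<Longrightarrow> nY v \<le> r \<Longrightarrow> 0 \<le> F t v + \<gamma> *\<^sub>R H v"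
    using F_H \<tau>(2) r(1) by metis
  obtain U where U_gen: "generates D (\<lambda>x. G x - \<gamma> *\<^sub>R H x) U" and U_pos: "positive_semigroup U"
    using H_gen \<gamma>(1) by blast
  interpret perturbed_semigroup Y nY S \<eta> D G H K \<gamma> U
    by (rule perturbed[OF \<gamma>(1) U_gen])
  have U_le_S: "U t x \<le> S t x" if "0 \<le> t" "0 \<le> x" for t x
    by (rule perturbed_semigroup_dominated[OF perturbed_semigroup_axioms X_lat S_pos U_pos H_pos that])
  obtain L where L: "\<And>t f g. t \<in> {0..\<tau>} \<Longrightarrow> f \<in> Y \<Longrightarrow> g \<in> Y \<Longrightarrow> nY f \<le> r \<Longrightarrow> nY g \<le> r \<Longrightarrow>
      norm (F t f - F t g) \<le> L * nY (f - g)"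
    using F_Lip \<tau>(2) r(1) unfolding F_loc_Lipschitz_def by metis

  define p n where "p s = sup (u s) 0" and "n s = sup (- u s) 0" for s
  have sup0_Y: "sup y 0 \<in> Y" if "y \<in> Y" for y
    using Y_lat that Y_0 by (auto simp: banach_sublattice_def)
  have p_Y: "p s \<in> Y" and n_Y: "n s \<in> Y" if "s \<in> {0..\<tau>}" for s
    using u_Y[OF that] by (auto simp: p_def n_def intro!: sup0_Y Y_neg)
  have p_n: "p s - n s = u s" for s
    by (simp add: p_def n_def sup_zero_minus)
  have sup0_diff: "nY (sup y 0 - sup z 0) \<le> nY (y - z)" if "y \<in> Y" "z \<in> Y" for y z
    using Y_lat that lmod_sup_zero_diff[of y z] sup0_Y Y_diff by (auto simp: banach_sublattice_def)
  have p_diff: "nY (p s - p t) \<le> nY (u s - u t)" if "s \<in> {0..\<tau>}" "t \<in> {0..\<tau>}" for s t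
    using sup0_diff u_Y that by (simp add: p_def)
  have n_diff: "nY (n s - n t) \<le> nY (u s - u t)" if "s \<in> {0..\<tau>}" "t \<in> {0..\<tau>}" for s t
    using sup0_diff[OF Y_neg Y_neg, of "u s" "u t"] u_Y that nY_commute[of "u s" "u t"]
    by (simp add: n_def)
  have p_cont: "Ycontinuous_on nY {0..\<tau>} p" and n_cont: "Ycontinuous_on nY {0..\<tau>} n"
    by (rule Ycontinuous_on_dominated[OF u_cont p_diff], assumption+)
      (rule Ycontinuous_on_dominated[OF u_cont n_diff], assumption+)
  have p_r: "nY (p s) \<le> r" if "s \<in> {0..\<tau>}" for s
    using sup0_diff[OF u_Y Y_0, of s] that r(2)[OF that] by (simp add: p_def)

  define g where "g s = F s (u s) - F s (p s) - \<gamma> *\<^sub>R H (n s)" for s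
  have F_u: "continuous_on {0..\<tau>} (\<lambda>s. F s (u s))" and F_p: "continuous_on {0..\<tau>} (\<lambda>s. F s (p s))"
    by (auto intro!: F_continuous_along_curve[OF F_cont sub(2)] u_cont p_cont u_Y p_Y)
  have g_cont: "continuous_on {0..\<tau>} (\<lambda>s. lmod (g s))"
    unfolding g_def by (intro continuous_on_lmod[OF X_lat] continuous_on_diff F_u F_p
        continuous_on_scaleR continuous_on_const continuous_on_H n_cont n_Y)
  \<comment> \<open>\<open>\<bar>L\<bar>\<close> accounts for \<open>u s - p s = - n s\<close> in
    \<open>F\<close>, and \<open>\<gamma> * K\<close> for \<open>H (n s)\<close>. The absolute value
    is taken because the Lipschitz condition leaves the sign of \<open>L\<close> open; the 1 makes
    \<open>C\<close> positive.\<close>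
  define C where "C = \<bar>L\<bar> + \<gamma> * K + 1"
  have C: "C > 0" using K(1) \<gamma>(1) by (simp add: C_def add_nonneg_pos)
  have g_bound: "norm (lmod (g s)) \<le> C * nY (n s)" if s: "s \<in> {0..\<tau>}" for s
  proof -
    have "norm (g s) \<le> norm (F s (u s) - F s (p s)) + norm (\<gamma> *\<^sub>R H (n s))"
      unfolding g_def by (rule norm_triangle_ineq4)
    also have "\<dots> \<le> L * nY (u s - p s) + \<gamma> * (K * nY (n s))"
      using L[OF s u_Y[OF s] p_Y[OF s] r(2)[OF s] p_r[OF s]] K(2) n_Y[OF s] \<gamma>(1)
      by (intro add_mono) (auto intro!: mult_left_mono)
    also have "u s - p s = - n s" by (simp flip: p_n)
    also have "L * nY (- n s) + \<gamma> * (K * nY (n s)) \<le> C * nY (n s)"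
    proof -
      have "L * nY (n s) \<le> (\<bar>L\<bar> + 1) * nY (n s)"
        using nY_nonneg[OF n_Y[OF s]] by (intro mult_right_mono) auto
      then show ?thesis by (simp add: nY_neg[OF n_Y[OF s]] C_def algebra_simps)
    qed
    finally show ?thesis by (simp add: norm_lmod[OF X_lat])
  qed

  \<comment> \<open>Writing \<open>F(s,u) + \<gamma>Hu = (F(s,u\<^sup>+) + \<gamma>Hu\<^sup>+) + g\<close>, the bracket is nonnegative by (f); the rest is
    estimated by \<open>U(t)g \<ge> - U(t)|g| \<ge> - S(t)|g|\<close>.\<close>
  have n_le: "n b \<le> integral {0..b} (\<lambda>s. S (b - s) (lmod (g s)))" (is "_ \<le> ?z") if b: "b \<in> {0..\<tau>}" for b
  proof -
    let ?k = "\<lambda>s. F s (u s) + \<gamma> *\<^sub>R H (u s)"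
    have sub_b: "{0..b} \<subseteq> {0..\<tau>}" using b by auto
    have "continuous_on {0..\<tau>} ?k"
      by (intro continuous_on_add F_u continuous_on_scaleR continuous_on_const continuous_on_H u_cont u_Y)
    then have int_k: "(\<lambda>s. U (b - s) (?k s)) integrable_on {0..b}"
      by (intro integrable_continuous_real continuous_on_C0_convolution[OF U] continuous_on_subset[OF _ sub_b])
    have int_g: "(\<lambda>s. S (b - s) (lmod (g s))) integrable_on {0..b}"
      by (intro integrable_continuous_real continuous_on_C0_convolution[OF S]
          continuous_on_subset[OF g_cont sub_b])
    have "u b = U b (u 0) + integral {0..b} (\<lambda>s. U (b - s) (?k s))"
    proof (rule variation_of_constants)
      show "u t = S t (u 0) + integral {0..t} (\<lambda>s. S (t - s) (F s (u s)))" if "t \<in> {0..b}" for t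
        using u_mild[of t] that sub_b u_0 by auto
    qed (use b sub_b u_Y in \<open>auto intro: Ycontinuous_on_subset[OF u_cont] continuous_on_subset[OF F_u]\<close>)
    then have "u b + ?z = U b u0 + integral {0..b} (\<lambda>s. U (b - s) (?k s) + S (b - s) (lmod (g s)))"
      by (simp add: u_0 integral_add[OF int_k int_g] add.assoc)
    also have "\<dots> \<ge> 0"
    proof (rule add_nonneg_nonneg)
      show "0 \<le> U b u0"
        using U_pos b u0_pos by (simp add: positive_semigroup_def)
      show "0 \<le> integral {0..b} (\<lambda>s. U (b - s) (?k s) + S (b - s) (lmod (g s)))"
      proof (rule integral_nonneg_banach_lattice[OF X_lat integrable_add[OF int_k int_g]])
        fix s assume "s \<in> {0..b}"
        then have s: "s \<in> {0..\<tau>}" "0 \<le> b - s" using sub_b by auto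
        interpret Ub: bounded_linear "U (b - s)"
          using C0_semigroup_bounded_linear[OF U s(2)] .
        have "H (u s) = H (p s) - H (n s)"
          using H_diff[OF p_Y n_Y, OF s(1) s(1)] p_n by simp
        then have "?k s = (F s (p s) + \<gamma> *\<^sub>R H (p s)) + g s"
          by (simp only: g_def scaleR_diff_right) simp
        moreover have "0 \<le> F s (p s) + \<gamma> *\<^sub>R H (p s)"
          using p_Y p_r s(1) by (intro \<gamma>(2)) (auto simp: p_def)
        moreover have "- g s \<le> lmod (g s)" by (rule lmod_ge)
        then have "0 \<le> lmod (g s) + g s"
          using le_diff_eq[of 0 "lmod (g s)" "- g s"] by simp
        ultimately have "0 \<le> ?k s + lmod (g s)"
          by (metis add.assoc add.commute add_nonneg_nonneg)
        then have "0 \<le> U (b - s) (?k s + lmod (g s))"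
          using U_pos s(2) unfolding positive_semigroup_def by blast
        also have "\<dots> = U (b - s) (?k s) + U (b - s) (lmod (g s))"
          by (rule Ub.add)
        \<comment> \<open>Domination replaces \<open>U\<close> by \<open>S\<close> on the error term
          because the smoothing estimate (b) concerns convolutions with \<open>S\<close>.\<close>
        also have "\<dots> \<le> U (b - s) (?k s) + S (b - s) (lmod (g s))"
          using s(2) by (intro add_left_mono U_le_S lmod_nonneg)
        finally show "0 \<le> U (b - s) (?k s) + S (b - s) (lmod (g s))" .
      qed
    qed
    finally have "- u b \<le> ?z"
      using le_diff_eq[of 0 ?z "- u b"] by (simp add: add.commute)
    moreover have "0 \<le> ?z"
      using S_pos b by (intro integral_nonneg_banach_lattice[OF X_lat int_g])
        (auto simp: positive_semigroup_def lmod_nonneg)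
    ultimately show ?thesis by (simp add: n_def)
  qed

  \<comment> \<open>By \<open>g_bound\<close>, \<open>g\<close> vanishes where \<open>n\<close>
    does, so the integral over \<open>{0..a}\<close> drops out and \<open>\<eta>\<close> is
    evaluated at \<open>b - a\<close> only. The lattice property of \<open>nY\<close> passes the
    bound from the integral to \<open>n b\<close>.\<close>
  have n_step: "nY (n b) \<le> \<eta> (b - a) * (C * m)"
    if ab: "0 \<le> a" "a < b" "b \<le> \<tau>" and zero: "\<And>s. s \<in> {0..a} \<Longrightarrow> n s = 0"
      and m: "\<And>s. s \<in> {a..b} \<Longrightarrow> nY (n s) \<le> m" for a b m
  proof -
    let ?z = "\<lambda>A. integral A (\<lambda>s. S (b - s) (lmod (g s)))"
    have "?z {0..a} = integral {0..a} (\<lambda>s. 0)"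
    proof (rule integral_cong)
      fix s assume s: "s \<in> {0..a}"
      then have "norm (lmod (g s)) \<le> 0"
        using g_bound[of s] zero[OF s] ab by simp
      then show "S (b - s) (lmod (g s)) = 0"
        using s ab by (simp add: linear_0 bounded_linear.linear C0_semigroup_bounded_linear[OF S])
    qed
    moreover have "?z {0..a} + ?z {a..b} = ?z {0..b}"
      using ab by (intro Henstock_Kurzweil_Integration.integral_combine integrable_continuous_real
          continuous_on_C0_convolution[OF S] continuous_on_subset[OF g_cont]) auto
    ultimately have z: "?z {0..b} = ?z {a..b}" by simp
    have est: "?z {a..b} \<in> Y" "nY (?z {a..b}) \<le> \<eta> (b - a) * (C * m)"
    proof -
      have bound: "norm (lmod (g s)) \<le> C * m" if "s \<in> {a..b}" for s
        using g_bound[of s] m[OF that] that ab C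
        by (meson atLeastAtMost_iff mult_left_mono order_trans less_imp_le)
      have cont: "continuous_on {a..b} (\<lambda>s. lmod (g s))"
        using ab by (intro continuous_on_subset[OF g_cont]) auto
      show "?z {a..b} \<in> Y" "nY (?z {a..b}) \<le> \<eta> (b - a) * (C * m)"
        using eta_bound[OF ab(1,2) cont bound] by auto
    qed
    have "0 \<le> n b" by (simp add: n_def)
    moreover have "n b \<le> ?z {a..b}" using n_le[of b] z ab by simp
    ultimately have "lmod (n b) \<le> lmod (?z {a..b})"
      using lmod_of_nonneg[of "n b"] lmod_ge(1)[of "?z {a..b}"] by (metis order_trans)
    then have "nY (n b) \<le> nY (?z {a..b})"
      using Y_lat n_Y[of b] est(1) ab by (auto simp: banach_sublattice_def)
    then show ?thesis using est(2) by simp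
  qed

  \<comment> \<open>This threshold makes the factor \<open>\<eta> (b - a) * C\<close> in
    \<open>n_step\<close> less than 1/2.\<close>
  have "\<forall>\<^sub>F d in at_right 0. \<eta> d < 1 / (2 * C)"
    using C by (intro order_tendstoD[OF eta_lim]) auto
  then obtain \<delta> where \<delta>: "\<delta> > 0" "\<And>d. 0 < d \<Longrightarrow> d < \<delta> \<Longrightarrow> \<eta> d < 1 / (2 * C)"
    unfolding eventually_at_right_field by blast
  \<comment> \<open>Steps of length \<open>\<delta> / 2\<close> keep each interval strictly shorter
    than \<open>\<delta>\<close>, and finitely many of them reach \<open>\<tau>\<close>.\<close>
  have "\<forall>s\<in>{0..min \<tau> (real k * (\<delta> / 2))}. n s = 0" for k
  proof (induction k)
    case 0
    have "n 0 = 0" using u_0 u0_pos by (simp add: n_def sup_absorb2)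
    then show ?case using \<tau>(1) by simp
  next
    case (Suc k)
    define a c where "a = min \<tau> (real k * (\<delta> / 2))" and "c = min \<tau> (real (Suc k) * (\<delta> / 2))"
    have ac: "0 \<le> a" "a \<le> c" "c \<le> \<tau>" "c - a < \<delta>"
      using \<delta>(1) \<tau>(1) by (auto simp: a_def c_def min_def field_simps)
    have zero: "n s = 0" if "s \<in> {0..a}" for s
      using Suc that by (simp add: a_def)
    have sub_ac: "{a..c} \<subseteq> {0..\<tau>}" using ac by auto
    have "continuous_on {a..c} (\<lambda>s. nY (n s))"
      by (rule Ycontinuous_imp_continuous_on_nY[OF Ycontinuous_on_subset[OF n_cont sub_ac]])
        (use n_Y sub_ac in auto)
    \<comment> \<open>At a maximum point \<open>b\<close> the bound \<open>m\<close> of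
      \<open>n_step\<close> may be \<open>nY (n b)\<close> itself, so this number is at most half of
      itself.\<close>
    then obtain b where b: "b \<in> {a..c}" "\<And>s. s \<in> {a..c} \<Longrightarrow> nY (n s) \<le> nY (n b)"
      using continuous_attains_sup[of "{a..c}" "\<lambda>s. nY (n s)"] ac by auto
    have b_Y: "n b \<in> Y" using b(1) sub_ac n_Y by blast
    have "nY (n b) \<le> 0"
    proof (cases "b = a")
      case True
      then show ?thesis using zero[of a] ac by simp
    next
      case False
      then have ab: "a < b" "b \<le> c" using b(1) by auto
      then have "nY (n b) \<le> \<eta> (b - a) * (C * nY (n b))"
        using ac b(2) zero by (intro n_step) auto
      also have "\<dots> \<le> 1 / (2 * C) * (C * nY (n b))"
        using \<delta>(2)[of "b - a"] ab ac nY_nonneg[OF b_Y] C by (intro mult_right_mono) auto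
      also have "\<dots> = nY (n b) / 2" using C by simp
      finally show ?thesis by simp
    qed
    then have "n s = 0" if "s \<in> {a..c}" for s
      using b(2)[OF that] nY_nonneg[OF n_Y] nY_eq_0[OF n_Y] that sub_ac
      by (metis order_trans order_antisym subsetD)
    with zero have "n s = 0" if "s \<in> {0..c}" for s
      using that by (cases "s \<le> a") auto
    then show ?case by (simp only: c_def) blast
  qed
  moreover obtain k :: nat where "\<tau> / (\<delta> / 2) < real k"
    using reals_Archimedean2 by blast
  then have "min \<tau> (real k * (\<delta> / 2)) = \<tau>"
    using \<delta>(1) by (simp add: field_simps)
  ultimately have "n \<tau> = 0"
    using \<tau>(1) by (metis atLeastAtMost_iff order_refl)
  then have "- u \<tau> \<le> 0"
    unfolding n_def by (metis sup_ge1)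
  then show "0 \<le> u \<tau>" by simp
qed

end
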